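(* There are no exceptional radial eigencubics of type $(3,8)$.
   Context: For a polynomial $f$ on $\mathbb{R}^n$ put $L(f)=|\nabla f|^2\Delta f-\sum_{i,j=1}^n f_{x_i}f_{x_j}f_{x_ix_j}$. A radial eigencubic in $\mathbb{R}^n$ is a homogeneous polynomial $f\not\equiv 0$ of degree 3 such that $L(f)=\lambda |x|^2 f$ for some constant $\lambda\in\mathbb{R}$, where it is assumed that $\lambda\neq 0$. Two cubic forms $f_1,f_2$ on $\mathbb{R}^n$ are congruent if $f_1(x)=cf_2(Ux)$ for some $U\in O(n)$ and some real $c\ne0$. Every radial eigencubic admits a normal form: an orthogonal decomposition $\mathbb{R}^n=\mathrm{span}(e_n)\oplus V_1\oplus V_2\oplus V_3$ ($e_n$ a unit vector, the $V_i$ possibly zero) such that, writing $x=x_ne_n+\xi+\eta+\zeta$ with $\xi\in V_1,\eta\in V_2,\zeta\in V_3$, after multiplication of $f$ by a nonzero constant, $$f=x_n^3-\tfrac32x_n(2|\xi|^2+|\eta|^2-|\zeta|^2)+\psi_{111}+\psi_{102}+\psi_{012}+\psi_{030},$$ where $\psi_{ijk}$ is homogeneous of degree $i$ in $\xi$, $j$ in $\eta$ and $k$ in $\zeta$. The type of $f$ is the pair $(n_1,n_2)=(\dim V_1,\dim V_2)$, which is independent of the normal form; one has $n=3n_1+2n_2-1$. For $m\ge1$, $q\ge0$, a symmetric Clifford system $\mathcal{A}=\{A_0,\dots,A_q\}\in\mathrm{Cliff}(\mathbb{R}^{2m},q)$ is a system of symmetric endomorphisms of $\mathbb{R}^{2m}$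 with $A_iA_j+A_jA_i=2\delta_{ij}\mathbf{1}$ (and, when $q=0$, $\operatorname{tr}A_0=0$). To it one associates the radial eigencubic $C_{\mathcal A}(z,y)=\sum_{i=0}^q\langle y,A_iy\rangle z_{i+1}$ on $\mathbb{R}^{q+1}\times\mathbb{R}^{2m}$. A radial eigencubic is exceptional if it is not congruent to any $C_{\mathcal A}$. *)

theory Defs
  imports "Jordan_Normal_Form.Matrix" "HOL-Analysis.Analysis"
begin

text \<open>
  Both matrix libraries use the infixes for indexing and for the scalar product; here they
  always mean the ones of HOL-Analysis.
\<close>
no_notation Matrix.vec_index (infixl "$" 100)
no_notation Matrix.scalar_prod (infix "\<bullet>" 70)

definition partial_deriv :: "'n \<Rightarrow> (real ^ 'n \<Rightarrow> real) \<Rightarrow> real ^ 'n::finite \<Rightarrow> real" where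
  "partial_deriv i f x = frechet_derivative f (at x) (axis i 1)"

definition L_op :: "(real ^ 'n::finite \<Rightarrow> real) \<Rightarrow> real ^ 'n \<Rightarrow> real" where
  "L_op f x =
     (\<Sum>i\<in>UNIV. (partial_deriv i f x)\<^sup>2) * (\<Sum>i\<in>UNIV. partial_deriv i (partial_deriv i f) x)
     - (\<Sum>i\<in>UNIV. \<Sum>j\<in>UNIV. partial_deriv i f x * partial_deriv j f x
                               * partial_deriv j (partial_deriv i f) x)"

definition homogeneous_polynomial :: "nat \<Rightarrow> ('a::real_normed_vector \<Rightarrow> real) \<Rightarrow> bool" where
  "homogeneous_polynomial d f \<longleftrightarrow>
     real_polynomial_function f \<and> (\<forall>t x. f (t *\<^sub>R x) = t ^ d * f x)"

definition radial_eigencubic :: "(real ^ 'n::finite \<Rightarrow> real) \<Rightarrow> bool" where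
  "radial_eigencubic f \<longleftrightarrow>
     homogeneous_polynomial 3 f \<and> (\<exists>x. f x \<noteq> 0) \<and>
     (\<exists>l. l \<noteq> 0 \<and> (\<forall>x. L_op f x = l * (norm x)\<^sup>2 * f x))"

definition congruent_cubics :: "(real ^ 'n::finite \<Rightarrow> real) \<Rightarrow> (real ^ 'n \<Rightarrow> real) \<Rightarrow> bool" where
  "congruent_cubics f1 f2 \<longleftrightarrow>
     (\<exists>U c. orthogonal_transformation U \<and> c \<noteq> 0 \<and> (\<forall>x. f1 x = c * f2 (U x)))"

text \<open>
  \<^term>\<open>\<psi>\<close> is homogeneous of degrees \<^term>\<open>i\<close>, \<^term>\<open>j\<close>, \<^term>\<open>k\<close> in
  \<^term>\<open>\<xi> \<in> V1\<close>, \<^term>\<open>\<eta> \<in> V2\<close>, \<^term>\<open>\<zeta> \<in> V3\<close>. Polynomials on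
  the subspaces are represented by polynomials on the ambient space, of which only the
  values on the subspaces matter. As \<^term>\<open>(0::real) ^ 0 = 1\<close>, degree 0 in a variable
  means independence of it.
\<close>
definition trihomogeneous ::
  "(real ^ 'n::finite) set \<Rightarrow> (real ^ 'n) set \<Rightarrow> (real ^ 'n) set \<Rightarrow> nat \<Rightarrow> nat \<Rightarrow> nat \<Rightarrow>
   (real ^ 'n \<Rightarrow> real ^ 'n \<Rightarrow> real ^ 'n \<Rightarrow> real) \<Rightarrow> bool" where
  "trihomogeneous V1 V2 V3 i j k \<psi> \<longleftrightarrow>
     real_polynomial_function (\<lambda>(\<xi>, \<eta>, \<zeta>). \<psi> \<xi> \<eta> \<zeta>) \<and>
     (\<forall>\<xi>\<in>V1. \<forall>\<eta>\<in>V2. \<forall>\<zeta>\<in>V3. \<forall>a b c.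
        \<psi> (a *\<^sub>R \<xi>) (b *\<^sub>R \<eta>) (c *\<^sub>R \<zeta>) = a ^ i * b ^ j * c ^ k * \<psi> \<xi> \<eta> \<zeta>)"

definition orthogonal_decomposition ::
  "real ^ 'n::finite \<Rightarrow> (real ^ 'n) set \<Rightarrow> (real ^ 'n) set \<Rightarrow> (real ^ 'n) set \<Rightarrow> bool" where
  "orthogonal_decomposition e V1 V2 V3 \<longleftrightarrow>
     norm e = 1 \<and> subspace V1 \<and> subspace V2 \<and> subspace V3 \<and>
     (\<forall>\<xi>\<in>V1. \<forall>\<eta>\<in>V2. \<forall>\<zeta>\<in>V3.
        orthogonal e \<xi> \<and> orthogonal e \<eta> \<and> orthogonal e \<zeta> \<and>
        orthogonal \<xi> \<eta> \<and> orthogonal \<xi> \<zeta> \<and> orthogonal \<eta> \<zeta>) \<and>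
     (\<forall>x. \<exists>t. \<exists>\<xi>\<in>V1. \<exists>\<eta>\<in>V2. \<exists>\<zeta>\<in>V3. x = t *\<^sub>R e + \<xi> + \<eta> + \<zeta>)"

definition normal_form ::
  "(real ^ 'n::finite \<Rightarrow> real) \<Rightarrow> real ^ 'n \<Rightarrow>
   (real ^ 'n) set \<Rightarrow> (real ^ 'n) set \<Rightarrow> (real ^ 'n) set \<Rightarrow> bool" where
  "normal_form f e V1 V2 V3 \<longleftrightarrow>
     orthogonal_decomposition e V1 V2 V3 \<and>
     (\<exists>c \<psi>111 \<psi>102 \<psi>012 \<psi>030.
        c \<noteq> 0 \<and>
        trihomogeneous V1 V2 V3 1 1 1 \<psi>111 \<and> trihomogeneous V1 V2 V3 1 0 2 \<psi>102 \<and>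
        trihomogeneous V1 V2 V3 0 1 2 \<psi>012 \<and> trihomogeneous V1 V2 V3 0 3 0 \<psi>030 \<and>
        (\<forall>t. \<forall>\<xi>\<in>V1. \<forall>\<eta>\<in>V2. \<forall>\<zeta>\<in>V3.
           c * f (t *\<^sub>R e + \<xi> + \<eta> + \<zeta>) =
             t ^ 3 - 3 / 2 * t * (2 * (norm \<xi>)\<^sup>2 + (norm \<eta>)\<^sup>2 - (norm \<zeta>)\<^sup>2)
             + \<psi>111 \<xi> \<eta> \<zeta> + \<psi>102 \<xi> \<eta> \<zeta> + \<psi>012 \<xi> \<eta> \<zeta> + \<psi>030 \<xi> \<eta> \<zeta>))"

text \<open>
  A relation rather than a function, since that the pair does not depend on the choice of
  the normal form is a theorem about radial eigencubics.
\<close>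
definition has_type :: "(real ^ 'n::finite \<Rightarrow> real) \<Rightarrow> nat \<Rightarrow> nat \<Rightarrow> bool" where
  "has_type f n1 n2 \<longleftrightarrow>
     (\<exists>e V1 V2 V3. normal_form f e V1 V2 V3 \<and> dim V1 = n1 \<and> dim V2 = n2)"

text \<open>
  The dimensions \<^term>\<open>q\<close> and \<^term>\<open>m\<close> are existentially quantified in the notion of an
  exceptional eigencubic, so endomorphisms and vectors here are those of the theory of
  matrices with explicit carriers.
\<close>
definition symmetric_clifford_system :: "nat \<Rightarrow> nat \<Rightarrow> (nat \<Rightarrow> real mat) \<Rightarrow> bool" where
  "symmetric_clifford_system m q A \<longleftrightarrow>
     m \<ge> 1 \<and>
     (\<forall>i\<le>q. A i \<in> carrier_mat (2 * m) (2 * m) \<and> transpose_mat (A i) = A i) \<and>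
     (\<forall>i\<le>q. \<forall>j\<le>q. A i * A j + A j * A i = (if i = j then 2 else 0) \<cdot>\<^sub>m 1\<^sub>m (2 * m)) \<and>
     (q = 0 \<longrightarrow> (\<Sum>k<2 * m. A 0 $$ (k, k)) = 0)"

text \<open>The coordinates of \<^term>\<open>z\<close> are numbered from 0, so the summand has index \<^term>\<open>i\<close>.\<close>
definition clifford_cubic ::
  "nat \<Rightarrow> (nat \<Rightarrow> real mat) \<Rightarrow> real Matrix.vec \<Rightarrow> real Matrix.vec \<Rightarrow> real" where
  "clifford_cubic q A z y =
     (\<Sum>i\<le>q. Matrix.scalar_prod y (A i *\<^sub>v y) * Matrix.vec_index z i)"

text \<open>
  A bijection of the disjoint union of the two coordinate sets with \<^typ>\<open>'n\<close> identifies
  the product of the spaces of dimensions \<^term>\<open>q + 1\<close> and \<^term>\<open>2 * m\<close> with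
  \<^typ>\<open>real ^ 'n\<close>; in particular it forces \<^term>\<open>CARD('n) = q + 1 + 2 * m\<close>. Different
  bijections differ by a permutation of coordinates, hence give congruent cubics.
\<close>
definition clifford_cubic_on ::
  "(nat + nat \<Rightarrow> 'n) \<Rightarrow> nat \<Rightarrow> nat \<Rightarrow> (nat \<Rightarrow> real mat) \<Rightarrow> real ^ 'n::finite \<Rightarrow> real" where
  "clifford_cubic_on \<sigma> m q A x =
     clifford_cubic q A (Matrix.vec (q + 1) (\<lambda>i. x $ \<sigma> (Inl i)))
                        (Matrix.vec (2 * m) (\<lambda>j. x $ \<sigma> (Inr j)))"

definition exceptional_eigencubic :: "(real ^ 'n::finite \<Rightarrow> real) \<Rightarrow> bool" where
  "exceptional_eigencubic f \<longleftrightarrow>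
     radial_eigencubic f \<and>
     \<not> (\<exists>m q A \<sigma>. symmetric_clifford_system m q A \<and>
          bij_betw \<sigma> ({..<q + 1} <+> {..<2 * m}) (UNIV :: 'n set) \<and>
          congruent_cubics f (clifford_cubic_on \<sigma> m q A))"

end

theory Submission
  imports Defs "HOL-Computational_Algebra.Polynomial"
begin

text \<open>
  Write the cubic as \<open>f x = (x \<star> x) \<bullet> x\<close> with a commutative product for which the form is
  associative. Expanding the eigencubic equation at \<open>t e + y\<close> in powers of \<open>t\<close> gives
  \<open>dim V3 = 2 dim V1 + dim V2 - 2\<close> and a quartic identity for the products of the Peirce
  spaces \<open>V1, V2, V3\<close>; e.g. \<open>2 (a \<star> _)\<close> maps \<open>V2\<close> into \<open>V3\<close> isometrically for every unit
  \<open>a \<in> V1\<close>.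

  In type (3,8), for orthonormal \<open>a, b \<in> V1\<close>, the complement of \<open>a \<star> V2\<close> in \<open>V3\<close> has dimension 4
  and carries a multiple of an involution, one of whose eigenspaces has dimension at most 2. Hence
  \<open>b \<star> x \<in> a \<star> V2\<close> for all \<open>x\<close> in a subspace \<open>K\<close> of \<open>V2\<close> of dimension at least 6, and this forces the
  cubic form \<open>\<psi>030\<close> to vanish on \<open>K\<close>. As \<open>\<psi>030\<close> solves an eiconal equation on \<open>V2\<close>, it is
  then a multiple of \<open>s^3 - 3 s |y|^2\<close> along some axis \<open>\<theta>\<close>. In this situation \<open>V1\<close> acts by
  similarities from \<open>V1 + (\<theta>-complement in V2)\<close> to another space of the same dimension 10. Three
  orthogonal such maps make a space of dimension 10 a quaternionic vector space, which is absurd.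
  So there is no radial eigencubic of type (3,8) at all, Clifford or not.
\<close>

section \<open>Linear algebra\<close>

lemma orthogonal_span_iff:
  fixes y :: "'a::euclidean_space"
  shows "(\<forall>x\<in>span F. orthogonal x y) \<longleftrightarrow> (\<forall>f\<in>F. f \<bullet> y = 0)"
proof
  assume "\<forall>x\<in>span F. orthogonal x y"
  then show "\<forall>f\<in>F. f \<bullet> y = 0" by (auto simp: orthogonal_def span_base)
next
  assume F: "\<forall>f\<in>F. f \<bullet> y = 0"
  have "x \<bullet> y = 0" if "x \<in> span F" for x
    using that by (induction rule: span_induct_alt) (use F in \<open>auto simp: inner_left_distrib\<close>)
  then show "\<forall>x\<in>span F. orthogonal x y" by (simp add: orthogonal_def)
qed

lemma dim_orthogonal_Int:
  fixes K :: "'a::euclidean_space set"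
  assumes K: "subspace K" and F: "finite F"
  shows "dim K \<le> dim {k \<in> K. \<forall>f\<in>F. f \<bullet> k = 0} + card F"
proof -
  let ?A = "{y \<in> UNIV. \<forall>x\<in>span F. orthogonal x y}"
  have A: "?A = {y. \<forall>f\<in>F. f \<bullet> y = 0}"
    by (simp add: orthogonal_span_iff)
  have sA: "subspace ?A"
    unfolding A by (auto simp: subspace_def inner_right_distrib)
  have "dim ?A + dim (span F) = DIM('a)"
    using dim_subspace_orthogonal_to_vectors[of "span F" UNIV] by simp
  moreover have "dim (span F) \<le> card F"
    using dim_le_card'[OF F] by simp
  moreover have "dim {x + y |x y. x \<in> K \<and> y \<in> ?A} + dim (K \<inter> ?A) = dim K + dim ?A"
    by (rule dim_sums_Int[OF K sA])
  moreover have "dim {x + y |x y. x \<in> K \<and> y \<in> ?A} \<le> DIM('a)"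
    by (rule dim_subset_UNIV)
  moreover have "K \<inter> ?A = {k \<in> K. \<forall>f\<in>F. f \<bullet> k = 0}"
    unfolding A by auto
  ultimately show ?thesis by simp
qed

lemma ex_unit_orthogonal:
  fixes K :: "'a::euclidean_space set"
  assumes K: "subspace K" and F: "finite F" and card: "card F < dim K"
  shows "\<exists>k\<in>K. norm k = 1 \<and> (\<forall>f\<in>F. f \<bullet> k = 0)"
proof -
  have "\<not> {k \<in> K. \<forall>f\<in>F. f \<bullet> k = 0} \<subseteq> {0}"
  proof
    assume "{k \<in> K. \<forall>f\<in>F. f \<bullet> k = 0} \<subseteq> {0}"
    then have "dim {k \<in> K. \<forall>f\<in>F. f \<bullet> k = 0} = 0" by (rule dim_eq_0[THEN iffD2])
    then show False using dim_orthogonal_Int[OF K F] card by linarith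
  qed
  then obtain k where k: "k \<in> K" "\<forall>f\<in>F. f \<bullet> k = 0" "k \<noteq> 0"
    by blast
  show ?thesis
  proof (intro bexI conjI)
    show "norm (k /\<^sub>R norm k) = 1" using k(3) by simp
    show "\<forall>f\<in>F. f \<bullet> (k /\<^sub>R norm k) = 0" using k(2) by simp
    show "k /\<^sub>R norm k \<in> K" using K k(1) by (simp add: subspace_scale)
  qed
qed

lemma dim_sums_orthogonal:
  fixes S T :: "'a::euclidean_space set"
  assumes "subspace S" "subspace T" "\<And>x y. x \<in> S \<Longrightarrow> y \<in> T \<Longrightarrow> x \<bullet> y = 0"
  shows "dim {x + y |x y. x \<in> S \<and> y \<in> T} = dim S + dim T"
proof -
  have "S \<inter> T \<subseteq> {0}" using assms(3) by force
  then have "dim (S \<inter> T) = 0" by simp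
  then show ?thesis using dim_sums_Int[OF assms(1,2)] by linarith
qed

text \<open>The trace is recorded because the trace of multiplication by the idempotent is later
  computed as a sum over the Peirce projections. In an orthonormal basis \<open>B\<close> of
  \<open>V\<close> it is the sum of the squared lengths of the members of \<open>B\<close>.\<close>

lemma ex_orthogonal_projection:
  fixes V :: "'a::euclidean_space set"
  assumes "subspace V"
  obtains p :: "'a \<Rightarrow> 'a" where "linear p" "\<And>x. p x \<in> V" "\<And>x v. v \<in> V \<Longrightarrow> p x \<bullet> v = x \<bullet> v"
    "(\<Sum>b\<in>Basis. p b \<bullet> b) = dim V"
proof -
  obtain B where B: "B \<subseteq> V" "pairwise orthogonal B" "\<And>x. x \<in> B \<Longrightarrow> norm x = 1"
    "independent B" "card B = dim V" "span B = V"
    using orthonormal_basis_subspace[OF assms] by blast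
  have fin: "finite B" using B(4) by (rule independent_imp_finite)
  have one: "c \<bullet> c = 1" if "c \<in> B" for c
    using B(3)[OF that] by (simp add: norm_eq_1)
  define p where "p x = (\<Sum>c\<in>B. (x \<bullet> c) *\<^sub>R c)" for x
  show thesis
  proof (rule that)
    show "linear p"
      unfolding p_def
      by (rule linearI)
        (simp_all add: inner_left_distrib scaleR_left_distrib sum.distrib scaleR_right.sum)
    show "p x \<in> V" for x
      unfolding p_def using B(1) assms by (intro subspace_sum subspace_scale) auto
    show "p x \<bullet> v = x \<bullet> v" if "v \<in> V" for x v
    proof -
      have "v \<in> span B" using that B(6) by simp
      then show ?thesis
      proof (induction rule: span_induct_alt)
        case base show ?case by simp
      next
        case (step a d y)
        have "p x \<bullet> d = (\<Sum>c\<in>B. (x \<bullet> c) * (c \<bullet> d))"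
          by (simp add: p_def inner_sum_left)
        also have "\<dots> = (\<Sum>c\<in>B. if c = d then x \<bullet> d else 0)"
          using B(2) step(1) one by (intro sum.cong) (auto simp: pairwise_def orthogonal_def)
        also have "\<dots> = x \<bullet> d" using fin step(1) by simp
        finally show ?case using step by (simp add: inner_right_distrib)
      qed
    qed
    have "(\<Sum>b\<in>Basis. p b \<bullet> b) = (\<Sum>b\<in>Basis. \<Sum>c\<in>B. (b \<bullet> c) * (c \<bullet> b))"
      by (simp only: p_def inner_sum_left inner_scaleR_left)
    also have "\<dots> = (\<Sum>c\<in>B. \<Sum>b\<in>Basis. (c \<bullet> b) * (c \<bullet> b))"
      by (subst sum.swap) (simp only: inner_commute)
    also have "\<dots> = (\<Sum>c\<in>B. c \<bullet> c)"
      by (rule sum.cong[OF refl]) (rule euclidean_inner[symmetric])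
    also have "\<dots> = dim V" using one B(5) by simp
    finally show "(\<Sum>b\<in>Basis. p b \<bullet> b) = dim V" .
  qed
qed

section \<open>Quaternionic structures from orthogonal isometries\<close>

text \<open>Polarising the hypotheses makes \<open>I\<close> and \<open>J\<close> skew orthogonal
  maps of \<open>U\<close> that anticommute, so \<open>U\<close> becomes a module over the
  quaternions. These relations are used only through inner products, and the induction splits off
  one quaternionic line at a time.\<close>

lemma dim_quaternionic:
  fixes U :: "'a::euclidean_space set"
  assumes "subspace U"
    and "linear I" "linear J" "\<And>u. u \<in> U \<Longrightarrow> I u \<in> U" "\<And>u. u \<in> U \<Longrightarrow> J u \<in> U"
    and "\<And>u. u \<in> U \<Longrightarrow> norm (I u) = norm u" "\<And>u. u \<in> U \<Longrightarrow> norm (J u) = norm u"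
    and "\<And>u. u \<in> U \<Longrightarrow> u \<bullet> I u = 0" "\<And>u. u \<in> U \<Longrightarrow> u \<bullet> J u = 0" "\<And>u. u \<in> U \<Longrightarrow> I u \<bullet> J u = 0"
  shows "4 dvd dim U"
  using assms
proof (induction "dim U" arbitrary: U rule: less_induct)
  case less
  note sU = less.prems(1) and lI = less.prems(2) and lJ = less.prems(3)
    and IU = less.prems(4) and JU = less.prems(5)
  show ?case
  proof (cases "U \<subseteq> {0}")
    case True
    then have "dim U = 0" by simp
    then show ?thesis by (simp only: dvd_0_right)
  next
    case False
    then obtain u where u: "u \<in> U" "u \<noteq> 0" by blast
    have add: "x + y \<in> U" if "x \<in> U" "y \<in> U" for x y
      using sU that by (simp add: subspace_add)
    have II: "I x \<bullet> I y = x \<bullet> y" if "x \<in> U" "y \<in> U" for x y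
      using less.prems(6)[OF add[OF that]] less.prems(6)[OF that(1)] less.prems(6)[OF that(2)]
      by (simp add: norm_eq linear_add[OF lI] inner_simps inner_commute)
    have JJ: "J x \<bullet> J y = x \<bullet> y" if "x \<in> U" "y \<in> U" for x y
      using less.prems(7)[OF add[OF that]] less.prems(7)[OF that(1)] less.prems(7)[OF that(2)]
      by (simp add: norm_eq linear_add[OF lJ] inner_simps inner_commute)
    have sI: "I x \<bullet> y = - (x \<bullet> I y)" if "x \<in> U" "y \<in> U" for x y
      using less.prems(8)[OF add[OF that]] less.prems(8)[OF that(1)] less.prems(8)[OF that(2)]
      by (simp add: linear_add[OF lI] inner_simps inner_commute)
    have sJ: "J x \<bullet> y = - (x \<bullet> J y)" if "x \<in> U" "y \<in> U" for x y
      using less.prems(9)[OF add[OF that]] less.prems(9)[OF that(1)] less.prems(9)[OF that(2)]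
      by (simp add: linear_add[OF lJ] inner_simps inner_commute)
    have sIJ: "I x \<bullet> J y = - (J x \<bullet> I y)" if "x \<in> U" "y \<in> U" for x y
      using less.prems(10)[OF add[OF that]] less.prems(10)[OF that(1)] less.prems(10)[OF that(2)]
      by (simp add: linear_add[OF lI] linear_add[OF lJ] inner_simps inner_commute)
    \<comment> \<open>An orthogonal basis of the quaternionic line through \<open>u\<close>. Its
      complement \<open>W\<close> in \<open>U\<close> has dimension smaller by 4 and is again
      invariant under \<open>I\<close> and \<open>J\<close>.\<close>
    define S where "S = {u, I u, J u, I (J u)}"
    have SU: "S \<subseteq> U" using u IU JU by (auto simp: S_def)
    have uu: "u \<bullet> u > 0" using u by simp
    have o: "u \<bullet> I u = 0" "u \<bullet> J u = 0" "I u \<bullet> J u = 0" "u \<bullet> I (J u) = 0"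
      "I u \<bullet> I (J u) = 0" "J u \<bullet> I (J u) = 0"
      using less.prems(8-10)[OF u(1)] less.prems(8)[OF JU[OF u(1)]] II[OF u(1) JU[OF u(1)]]
        sI[OF u(1) JU[OF u(1)]] by simp_all
    have n: "I u \<bullet> I u = u \<bullet> u" "J u \<bullet> J u = u \<bullet> u" "I (J u) \<bullet> I (J u) = u \<bullet> u"
      using II[OF u(1) u(1)] JJ[OF u(1) u(1)] II[OF JU[OF u(1)] JU[OF u(1)]] by simp_all
    have card: "card S = 4"
    proof -
      have "u \<noteq> I u" "u \<noteq> J u" "u \<noteq> I (J u)" "I u \<noteq> J u" "I u \<noteq> I (J u)" "J u \<noteq> I (J u)"
        using o n uu by fastforce+
      then show ?thesis by (simp add: S_def)
    qed
    have "pairwise orthogonal S"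
      using o by (auto simp: pairwise_def orthogonal_def S_def inner_commute)
    moreover have "0 \<notin> S" using n uu unfolding S_def by auto
    ultimately have ind: "independent S" by (rule pairwise_orthogonal_independent)
    then have dS: "dim (span S) = 4" using card dim_span_eq_card_independent by fastforce
    define W where "W = {y \<in> U. \<forall>x\<in>span S. orthogonal x y}"
    have W: "W = {y \<in> U. \<forall>x\<in>S. x \<bullet> y = 0}"
      by (simp add: W_def orthogonal_span_iff)
    have dW: "dim W + 4 = dim U"
      using dim_subspace_orthogonal_to_vectors[of "span S" U] SU sU dS
      by (simp add: W_def span_minimal)
    have Wp: "w \<in> U" "u \<bullet> w = 0" "I u \<bullet> w = 0" "J u \<bullet> w = 0" "I (J u) \<bullet> w = 0" if "w \<in> W" for w
      using that by (auto simp: W S_def)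
    have memW: "w \<in> W" if "w \<in> U" "u \<bullet> w = 0" "I u \<bullet> w = 0" "J u \<bullet> w = 0" "I (J u) \<bullet> w = 0" for w
      using that by (auto simp: W S_def)
    have "4 dvd dim W"
    proof (rule less.hyps)
      show "dim W < dim U" using dW by simp
      show "subspace W" using sU unfolding W
        by (auto simp: subspace_def inner_right_distrib)
      show "linear I" "linear J" by fact+
      show "I w \<in> W" if "w \<in> W" for w
      proof (rule memW)
        note w = Wp[OF that]
        show "I w \<in> U" using w IU by blast
        show "u \<bullet> I w = 0" using sI[OF u(1) w(1)] w by simp
        show "I u \<bullet> I w = 0" using II[OF u(1) w(1)] w by simp
        show "J u \<bullet> I w = 0" using sI[OF JU[OF u(1)] w(1)] w by simp
        show "I (J u) \<bullet> I w = 0" using II[OF JU[OF u(1)] w(1)] w by simp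
      qed
      show "J w \<in> W" if "w \<in> W" for w
      proof (rule memW)
        note w = Wp[OF that]
        show "J w \<in> U" using w JU by blast
        show "u \<bullet> J w = 0" using sJ[OF u(1) w(1)] w by simp
        show "I u \<bullet> J w = 0" using sJ[OF IU[OF u(1)] w(1)] sIJ[OF u(1) w(1)]
          sI[OF JU[OF u(1)] w(1)] w by simp
        show "J u \<bullet> J w = 0" using JJ[OF u(1) w(1)] w by simp
        \<comment> \<open>Anticommutation, skewness and isometry of \<open>J\<close> are applied in
          turn, until only \<open>u \<bullet> I w\<close> is left.\<close>
        have "I (J u) \<bullet> J w = - (J (J u) \<bullet> I w)" by (rule sIJ[OF JU[OF u(1)] w(1)])
        also have "\<dots> = J u \<bullet> J (I w)" using sJ[OF JU[OF u(1)] IU[OF w(1)]] by simp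
        also have "\<dots> = u \<bullet> I w" by (rule JJ[OF u(1) IU[OF w(1)]])
        also have "\<dots> = 0" using sI[OF u(1) w(1)] w by simp
        finally show "I (J u) \<bullet> J w = 0" .
      qed
      show "norm (I w) = norm w" "norm (J w) = norm w" "w \<bullet> I w = 0" "w \<bullet> J w = 0"
        "I w \<bullet> J w = 0" if "w \<in> W" for w
        by (fact less.prems(6-10)[OF Wp(1)[OF that]])+
    qed
    then show ?thesis using dvd_add[of 4 "dim W" 4] dW by simp
  qed
qed

text \<open>\<open>X1\<close> is injective, hence onto \<open>V\<close> by the dimension bound.
  Composing \<open>X2\<close> and \<open>X3\<close> with its inverse \<open>G\<close> gives the two
  maps that \<open>dim_quaternionic\<close> asks for.\<close>

lemma dim_three_orthogonal_isometries:
  fixes U :: "'a::euclidean_space set" and V :: "'b::euclidean_space set"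
  assumes U: "subspace U" and V: "subspace V" and dim: "dim V \<le> dim U"
    and lin: "linear X1" "linear X2" "linear X3"
    and im: "\<And>u. u \<in> U \<Longrightarrow> X1 u \<in> V" "\<And>u. u \<in> U \<Longrightarrow> X2 u \<in> V" "\<And>u. u \<in> U \<Longrightarrow> X3 u \<in> V"
    and norm: "\<And>u. u \<in> U \<Longrightarrow> norm (X1 u) = norm u" "\<And>u. u \<in> U \<Longrightarrow> norm (X2 u) = norm u"
      "\<And>u. u \<in> U \<Longrightarrow> norm (X3 u) = norm u"
    and orth: "\<And>u. u \<in> U \<Longrightarrow> X1 u \<bullet> X2 u = 0" "\<And>u. u \<in> U \<Longrightarrow> X1 u \<bullet> X3 u = 0"
      "\<And>u. u \<in> U \<Longrightarrow> X2 u \<bullet> X3 u = 0"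
  shows "4 dvd dim U"
proof -
  have X0: "X1 u = 0 \<Longrightarrow> u = 0" if "u \<in> U" for u using norm(1)[OF that] by simp
  have inj: "inj_on X1 U"
    by (rule inj_onI) (metis X0 U eq_iff_diff_eq_0 lin(1) linear_diff subspace_diff)
  then have "dim (X1 ` U) = dim U"
    using dim_image_eq[of X1 U] lin(1) U by (simp add: span_eq_iff[THEN iffD2])
  then have surj: "X1 ` U = V"
    using subspace_dim_equal[of "X1 ` U" V] dim V im(1) linear_subspace_image[OF lin(1) U]
    by auto
  obtain G where G: "linear G" "G ` V \<subseteq> U" "\<And>v. v \<in> V \<Longrightarrow> X1 (G v) = v"
    using linear_exists_right_inverse_on[OF lin(1) U] surj by auto
  have sX: "X1 u \<bullet> X1 w = u \<bullet> w" if "u \<in> U" "w \<in> U" for u w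
    using norm(1)[OF subspace_add[OF U that]] norm(1)[OF that(1)] norm(1)[OF that(2)]
    by (simp add: norm_eq linear_add[OF lin(1)] inner_simps inner_commute)
  have GU: "G v \<in> U" if "v \<in> V" for v using G(2) that by blast
  have GG: "G v \<bullet> G w = v \<bullet> w" if "v \<in> V" "w \<in> V" for v w
    using sX[OF GU[OF that(1)] GU[OF that(2)]] G(3) that by simp
  have uG: "u \<bullet> G v = X1 u \<bullet> v" if "u \<in> U" "v \<in> V" for u v
    using sX[OF that(1) GU[OF that(2)]] G(3) that by simp
  show ?thesis
  proof (rule dim_quaternionic[OF U, of "\<lambda>u. G (X2 u)" "\<lambda>u. G (X3 u)"])
    show "linear (\<lambda>u. G (X2 u))" "linear (\<lambda>u. G (X3 u))"
      using linear_compose[OF lin(2) G(1)] linear_compose[OF lin(3) G(1)] by (simp_all add: o_def)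
    show "G (X2 u) \<in> U" "G (X3 u) \<in> U" if "u \<in> U" for u
      using GU im that by blast+
    show "norm (G (X2 u)) = norm u" "norm (G (X3 u)) = norm u" if "u \<in> U" for u
      using GG[OF im(2)[OF that] im(2)[OF that]] GG[OF im(3)[OF that] im(3)[OF that]] norm[OF that]
      by (simp_all add: norm_eq)
    show "u \<bullet> G (X2 u) = 0" "u \<bullet> G (X3 u) = 0" "G (X2 u) \<bullet> G (X3 u) = 0" if "u \<in> U" for u
      using uG[OF that im(2)[OF that]] uG[OF that im(3)[OF that]]
        GG[OF im(2)[OF that] im(3)[OF that]] orth[OF that] by simp_all
  qed
qed

section \<open>A quadratic inequality and the rigidity of eiconal cubics\<close>

lemma nonneg_quadratic_linear_coeff:
  fixes b c :: real
  assumes "\<And>t. 0 \<le> 2 * t * b + t\<^sup>2 * c"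
  shows "b = 0"
proof (rule ccontr)
  assume "b \<noteq> 0"
  \<comment> \<open>The quadratic is tested at t = -b/d. Since d exceeds c, its value (b^2/d) (c/d -
    2) there is negative.\<close>
  define d where "d = 1 + \<bar>c\<bar>"
  have d: "d > 0" "c < d" by (auto simp: d_def)
  have "2 * (- b / d) * b + (- b / d)\<^sup>2 * c = b\<^sup>2 / d * (c / d - 2)"
    using d by (simp add: field_simps power2_eq_square)
  moreover have "b\<^sup>2 / d * (c / d - 2) < 0"
  proof (rule mult_pos_neg)
    show "b\<^sup>2 / d > 0" using d \<open>b \<noteq> 0\<close> by simp
    show "c / d - 2 < 0" using d by (simp add: field_simps)
  qed
  ultimately have "2 * (- b / d) * b + (- b / d)\<^sup>2 * c < 0"
    by linarith
  then show False using assms[of "- b / d"] by linarith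
qed

text \<open>The hypothesis \<open>eik\<close> is the eiconal equation for the cubic form
  \<open>N a a \<bullet> a\<close>, whose gradient on \<open>V\<close> is
  \<open>3 *\<^sub>R N a a\<close>. Products of vectors of \<open>K\<close> lie in the complement of
  \<open>K\<close> in \<open>V\<close>, of dimension at most 2. As \<open>K\<close> is large enough
  to find unit vectors satisfying several linear conditions, all unit vectors of \<open>K\<close>
  turn out to have the same square, and this square is the axis \<theta>.\<close>

lemma rigid_eiconal_product:
  fixes N :: "'a::euclidean_space \<Rightarrow> 'a \<Rightarrow> 'a"
  assumes bil: "bilinear N" and comm: "\<And>a b. N a b = N b a"
    and V: "subspace V" and NV: "\<And>a b. a \<in> V \<Longrightarrow> b \<in> V \<Longrightarrow> N a b \<in> V"
    and assoc: "\<And>a b c. a \<in> V \<Longrightarrow> b \<in> V \<Longrightarrow> c \<in> V \<Longrightarrow> N a b \<bullet> c = a \<bullet> N b c"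
    and eik: "\<And>a. a \<in> V \<Longrightarrow> N a a \<bullet> N a a = (a \<bullet> a)\<^sup>2 / 2"
    and K: "subspace K" "K \<subseteq> V" "6 \<le> dim K" "dim V \<le> dim K + 2"
    and NK: "\<And>a b c. a \<in> K \<Longrightarrow> b \<in> K \<Longrightarrow> c \<in> K \<Longrightarrow> N a b \<bullet> c = 0"
  shows "\<exists>\<theta>\<in>V. \<theta> \<bullet> \<theta> = 1 / 2 \<and> N \<theta> \<theta> = - (1 / 2) *\<^sub>R \<theta> \<and>
    (\<forall>b\<in>V. b \<bullet> \<theta> = 0 \<longrightarrow> N \<theta> b = (1 / 2) *\<^sub>R b)"
proof -
  note bs = bilinear_ladd[OF bil] bilinear_radd[OF bil] bilinear_lmul[OF bil] bilinear_rmul[OF bil]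
    bilinear_lneg[OF bil] bilinear_rneg[OF bil] bilinear_lsub[OF bil] bilinear_rsub[OF bil]
  have Vadd: "a + b \<in> V" if "a \<in> V" "b \<in> V" for a b using V that by (simp add: subspace_add)
  have Vmul: "t *\<^sub>R a \<in> V" if "a \<in> V" for a t using V that by (simp add: subspace_scale)
  have KV: "a \<in> V" if "a \<in> K" for a using K(2) that by blast
  have pol: "2 * (N a a \<bullet> N a b) = (a \<bullet> a) * (a \<bullet> b)"
    "N a a \<bullet> N b b + 2 * (N a b \<bullet> N a b) = (a \<bullet> a) * (b \<bullet> b) / 2 + (a \<bullet> b)\<^sup>2"
    if "a \<in> V" "b \<in> V" for a b
  proof -
    have e: "N (a + t *\<^sub>R b) (a + t *\<^sub>R b) \<bullet> N (a + t *\<^sub>R b) (a + t *\<^sub>R b)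
        = ((a + t *\<^sub>R b) \<bullet> (a + t *\<^sub>R b))\<^sup>2 / 2" for t
      using eik that by (simp add: Vadd Vmul)
    have l: "N (a + t *\<^sub>R b) (a + t *\<^sub>R b) \<bullet> N (a + t *\<^sub>R b) (a + t *\<^sub>R b)
        = N a a \<bullet> N a a + 4 * t * (N a a \<bullet> N a b)
          + t\<^sup>2 * (2 * (N a a \<bullet> N b b) + 4 * (N a b \<bullet> N a b))
          + 4 * t^3 * (N a b \<bullet> N b b) + t^4 * (N b b \<bullet> N b b)" for t
    proof -
      have "N (a + t *\<^sub>R b) (a + t *\<^sub>R b) = N a a + (t *\<^sub>R N a b + t *\<^sub>R N a b) + t\<^sup>2 *\<^sub>R N b b"
        by (simp add: bs comm[of b a] power2_eq_square scaleR_right_distrib)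
      then show ?thesis
        by (simp add: inner_add_left inner_add_right inner_commute[of "N a b" "N a a"]
          inner_commute[of "N b b" "N a a"] inner_commute[of "N b b" "N a b"]
          algebra_simps power2_eq_square power3_eq_cube power4_eq_xxxx)
    qed
    have r: "((a + t *\<^sub>R b) \<bullet> (a + t *\<^sub>R b))\<^sup>2 / 2
        = (a \<bullet> a)\<^sup>2 / 2 + 2 * t * (a \<bullet> a) * (a \<bullet> b)
          + t\<^sup>2 * ((a \<bullet> a) * (b \<bullet> b) + 2 * (a \<bullet> b)\<^sup>2)
          + 2 * t^3 * (a \<bullet> b) * (b \<bullet> b) + t^4 * (b \<bullet> b)\<^sup>2 / 2" for t
      by (simp add: inner_add_left inner_add_right inner_commute[of b a]
        algebra_simps power2_eq_square power3_eq_cube power4_eq_xxxx)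
    \<comment> \<open>Both sides are quartic polynomials in t. The equations for \<open>a\<close>
      and \<open>b\<close> alone supply the constant and leading coefficients, and the four values
      at 1, -1, 2, -2 then separate the other three.\<close>
    note eqs = e[of 1, unfolded l r] e[of "-1", unfolded l r] e[of 2, unfolded l r]
      e[of "-2", unfolded l r] eik[OF that(1)] eik[OF that(2)]
    show "2 * (N a a \<bullet> N a b) = (a \<bullet> a) * (a \<bullet> b)"
      using eqs by (simp add: algebra_simps)
    show "N a a \<bullet> N b b + 2 * (N a b \<bullet> N a b) = (a \<bullet> a) * (b \<bullet> b) / 2 + (a \<bullet> b)\<^sup>2"
      using eqs by (simp add: algebra_simps)
  qed
  \<comment> \<open>The second identity of \<open>pol\<close>, polarised in \<open>b\<close> and
    with one argument freed by associativity, becomes an identity between vectors.\<close>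
  have op: "N (N a a) b + 2 *\<^sub>R N a (N a b) = ((a \<bullet> a) / 2) *\<^sub>R b + (a \<bullet> b) *\<^sub>R a"
    if a: "a \<in> V" and b: "b \<in> V" for a b
  proof -
    let ?d = "N (N a a) b + 2 *\<^sub>R N a (N a b) - (((a \<bullet> a) / 2) *\<^sub>R b + (a \<bullet> b) *\<^sub>R a)"
    have "?d \<bullet> c = 0" if c: "c \<in> V" for c
    proof -
      have bc: "b + c \<in> V" using b c by (rule Vadd)
      have "2 * (N a a \<bullet> N b c) + 4 * (N a b \<bullet> N a c) = (a \<bullet> a) * (b \<bullet> c) + 2 * (a \<bullet> b) * (a \<bullet> c)"
        using pol(2)[OF a bc] pol(2)[OF a b] pol(2)[OF a c]
        by (simp add: bs inner_add_left inner_add_right comm[of c b] inner_commute[of c b]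
          inner_commute[of "N a c" "N a b"] algebra_simps power2_eq_square add_divide_distrib)
      moreover have "N (N a a) b \<bullet> c = N a a \<bullet> N b c"
        using assoc a b c NV by simp
      moreover have "N a (N a b) \<bullet> c = N a b \<bullet> N a c"
        using assoc[of "N a b" a c] comm[of a "N a b"] a b c NV by simp
      ultimately show ?thesis
        by (simp add: inner_add_left inner_diff_left)
    qed
    moreover have "?d \<in> V"
      using a b V by (intro subspace_diff subspace_add subspace_scale NV)
    ultimately have "?d \<bullet> ?d = 0" by blast
    then show ?thesis by simp
  qed
  define H where "H = {x \<in> V. \<forall>k\<in>K. orthogonal k x}"
  have sH: "subspace H" using V unfolding H_def orthogonal_def
    by (auto simp: subspace_def inner_right_distrib)
  have dH: "dim H \<le> 2"
    using dim_subspace_orthogonal_to_vectors[OF K(1) V K(2)] K(4) by (simp add: H_def)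
  have NH: "N k l \<in> H" if "k \<in> K" "l \<in> K" for k l
    using NV[OF KV[OF that(1)] KV[OF that(2)]] NK[OF that]
    by (auto simp: H_def orthogonal_def inner_commute)
  \<comment> \<open>Because \<open>H\<close> has dimension at most 2, one further vector
    \<open>u\<close> suffices besides \<open>h\<close>: membership in \<open>H\<close> and two
    scalar conditions then force a vector to vanish.\<close>
  have line: "\<exists>u\<in>H. \<forall>x\<in>H. x \<bullet> h = 0 \<longrightarrow> x \<bullet> u = 0 \<longrightarrow> x = 0" if h: "h \<in> H" "h \<noteq> 0" for h
  proof (cases "\<exists>u\<in>H. u \<bullet> h = 0 \<and> u \<noteq> 0")
    case True
    then obtain u where u: "u \<in> H" "u \<bullet> h = 0" "u \<noteq> 0" by blast
    have "x = 0" if x: "x \<in> H" "x \<bullet> h = 0" "x \<bullet> u = 0" for x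
    proof (rule ccontr)
      assume "x \<noteq> 0"
      have "card {h, u, x} = 3"
        using u x h \<open>x \<noteq> 0\<close> by (auto simp: card_insert_if)
      moreover have "independent {h, u, x}"
        using u x h \<open>x \<noteq> 0\<close>
        by (intro pairwise_orthogonal_independent)
          (auto simp: pairwise_def orthogonal_def inner_commute)
      moreover have "{h, u, x} \<subseteq> H" using u x h by simp
      ultimately have "3 \<le> dim H" using independent_card_le_dim by metis
      then show False using dH by simp
    qed
    then show ?thesis using u by blast
  next
    case False
    then show ?thesis using h by blast
  qed
  have half: "N k k \<bullet> N k k = 1 / 2" "N k k \<noteq> 0" if "k \<in> K" "norm k = 1" for k
    using eik[OF KV[OF that(1)]] that(2) by (auto simp: norm_eq_1)
  have ortho: "N k k \<bullet> N k l = 0" if "k \<in> K" "l \<in> K" "k \<bullet> l = 0" for k l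
    using pol(1)[OF KV KV] that by fastforce
  have same: "N k k = N l l" if k: "k \<in> K" "norm k = 1" and l: "l \<in> K" "norm l = 1" for k l
  proof -
    obtain u where u: "u \<in> H" "\<And>x. x \<in> H \<Longrightarrow> x \<bullet> N k k = 0 \<Longrightarrow> x \<bullet> u = 0 \<Longrightarrow> x = 0"
      using line[OF NH[OF k(1) k(1)] half(2)[OF k]] by blast
    obtain w where w: "w \<in> H" "\<And>x. x \<in> H \<Longrightarrow> x \<bullet> N l l = 0 \<Longrightarrow> x \<bullet> w = 0 \<Longrightarrow> x = 0"
      using line[OF NH[OF l(1) l(1)] half(2)[OF l]] by blast
    have uV: "u \<in> V" "w \<in> V" using u(1) w(1) by (auto simp: H_def)
    \<comment> \<open>Four linear conditions leave room for a unit vector \<open>m\<close> in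
      \<open>K\<close>. They make \<open>N k m\<close> orthogonal to \<open>N k k\<close> and to
      \<open>u\<close>, hence zero, and likewise \<open>N l m\<close>. Then
      \<open>N k k \<bullet> N m m = 1 / 2\<close> is equality in Cauchy-Schwarz, so
      \<open>N k k = N m m\<close>, and the same holds for \<open>l\<close>.\<close>
    have "card {k, l, N k u, N l w} < dim K"
      using K(3) card_length[of "[k, l, N k u, N l w]"] by simp
    then obtain m where m: "m \<in> K" "norm m = 1"
      "\<forall>f\<in>{k, l, N k u, N l w}. f \<bullet> m = 0"
      using ex_unit_orthogonal[OF K(1), of "{k, l, N k u, N l w}"] by auto
    have "N k m \<bullet> u = N k u \<bullet> m" "N l m \<bullet> w = N l w \<bullet> m"
      using assoc comm inner_commute KV k l m(1) uV by metis+
    then have "N k m = 0" "N l m = 0"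
      using u(2)[OF NH[OF k(1) m(1)]] w(2)[OF NH[OF l(1) m(1)]]
        ortho[OF k(1) m(1)] ortho[OF l(1) m(1)] m(3) by (auto simp: inner_commute)
    then have "N k k \<bullet> N m m = 1 / 2" "N l l \<bullet> N m m = 1 / 2"
      using pol(2)[OF KV[OF k(1)] KV[OF m(1)]] pol(2)[OF KV[OF l(1)] KV[OF m(1)]] k l m
      by (simp_all add: norm_eq_1)
    then have "(N k k - N m m) \<bullet> (N k k - N m m) = 0" "(N l l - N m m) \<bullet> (N l l - N m m) = 0"
      using half[OF k] half[OF l] half[OF m(1,2)]
      by (simp_all add: inner_diff_left inner_diff_right inner_commute)
    then show ?thesis by simp
  qed
  obtain k0 where k0: "k0 \<in> K" "norm k0 = 1"
    using ex_unit_orthogonal[OF K(1), of "{}"] K(3) by auto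
  define \<theta> where "\<theta> = N k0 k0"
  have \<theta>: "\<theta> \<in> V" "\<theta> \<in> H" "\<theta> \<bullet> \<theta> = 1 / 2" "\<theta> \<noteq> 0"
    using NV NH KV k0 half[OF k0] by (auto simp: \<theta>_def)
  have diag: "N k k = (k \<bullet> k) *\<^sub>R \<theta>" if "k \<in> K" for k
  proof (cases "k = 0")
    case True
    then show ?thesis using bilinear_lzero[OF bil] by simp
  next
    case False
    have "N (k /\<^sub>R norm k) (k /\<^sub>R norm k) = \<theta>"
      unfolding \<theta>_def using that False k0 K(1) by (intro same) (auto simp: subspace_scale)
    then have "(norm k * norm k) *\<^sub>R ((1 / (norm k * norm k)) *\<^sub>R N k k) = (norm k * norm k) *\<^sub>R \<theta>"
      by (simp add: bs field_simps)
    then show ?thesis using False by (simp add: dot_square_norm power2_eq_square)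
  qed
  have NKK: "N k l = (k \<bullet> l) *\<^sub>R \<theta>" if "k \<in> K" "l \<in> K" for k l
  proof -
    have "N (k + l) (k + l) = ((k + l) \<bullet> (k + l)) *\<^sub>R \<theta>"
      using diag K(1) that by (simp add: subspace_add)
    then have "2 *\<^sub>R N k l = 2 *\<^sub>R ((k \<bullet> l) *\<^sub>R \<theta>)"
      using diag[OF that(1)] diag[OF that(2)]
      by (simp add: bs comm[of l k] inner_add_left inner_add_right inner_commute[of l k]
        algebra_simps scaleR_2)
    then show ?thesis by (simp only: scaleR_cancel_left) simp
  qed
  have NtK: "N \<theta> l = (1 / 2) *\<^sub>R l" if l: "l \<in> K" for l
  proof -
    have "card {l} < dim K" using K(3) by simp
    then obtain k where k: "k \<in> K" "norm k = 1" "l \<bullet> k = 0"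
      using ex_unit_orthogonal[OF K(1), of "{l}"] by auto
    \<comment> \<open>Once \<open>N k l\<close> vanishes, \<open>op\<close> at the unit vector
      \<open>k\<close> loses its second term, and \<open>N k k\<close> is \<theta>.\<close>
    have "N k l = 0" using NKK[OF k(1) l] k(3) by (simp add: inner_commute)
    then show ?thesis
      using op[OF KV[OF k(1)] KV[OF l]] diag[OF k(1)] k bilinear_rzero[OF bil]
      by (simp add: inner_commute norm_eq_1)
  qed
  have Ntb: "N \<theta> b = (1 / 2) *\<^sub>R b" if b: "b \<in> V" "b \<bullet> \<theta> = 0" for b
  proof -
    obtain u where u: "u \<in> H" "\<And>x. x \<in> H \<Longrightarrow> x \<bullet> \<theta> = 0 \<Longrightarrow> x \<bullet> u = 0 \<Longrightarrow> x = 0"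
      using line[OF \<theta>(2)] \<theta>(4) by blast
    have uV: "u \<in> V" using u(1) by (auto simp: H_def)
    \<comment> \<open>The argument of \<open>NtK\<close> needs \<open>N k b = 0\<close>. This
      product lies in \<open>H\<close> because \<open>N k l\<close> is a multiple of \<theta> and
      \<open>b\<close> is orthogonal to \<theta>. It is orthogonal to \<theta> because
      \<open>k\<close> is orthogonal to \<open>b\<close>, and the condition on \<open>N b u\<close>
      excludes the remaining direction of \<open>H\<close>.\<close>
    have "card {b, N b u} < dim K" using K(3) card_length[of "[b, N b u]"] by simp
    then obtain k where k: "k \<in> K" "norm k = 1" "b \<bullet> k = 0" "N b u \<bullet> k = 0"
      using ex_unit_orthogonal[OF K(1), of "{b, N b u}"] by auto
    note kV = KV[OF k(1)]
    have "N k b \<bullet> l = 0" if "l \<in> K" for l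
      using assoc[OF b(1) kV KV[OF that]] NKK[OF k(1) that] b(2) comm[of k b] by simp
    then have "N k b \<in> H" using NV[OF kV b(1)] by (auto simp: H_def orthogonal_def inner_commute)
    moreover have "N k b \<bullet> \<theta> = 0"
      using assoc[OF b(1) kV \<theta>(1)] NtK[OF k(1)] comm[of k b] comm[of k \<theta>] k(3) by simp
    moreover have "N k b \<bullet> u = 0"
      using assoc[OF kV b(1) uV] k(4) by (simp add: inner_commute)
    ultimately have "N k b = 0" using u(2) by blast
    then show ?thesis
      using op[OF kV b(1)] diag[OF k(1)] k bilinear_rzero[OF bil]
      by (simp add: inner_commute norm_eq_1)
  qed
  have "N \<theta> \<theta> = - (1 / 2) *\<^sub>R \<theta>"
  proof -
    have "N k0 \<theta> = (1 / 2) *\<^sub>R k0" using NtK[OF k0(1)] comm by simp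
    moreover have "k0 \<bullet> \<theta> = 0" using \<theta>(2) k0(1) by (simp add: H_def orthogonal_def)
    ultimately have "N \<theta> \<theta> + \<theta> = (1 / 2) *\<^sub>R \<theta>"
      using op[OF KV[OF k0(1)] \<theta>(1)] k0 by (simp add: bs \<theta>_def[symmetric] norm_eq_1)
    then have "N \<theta> \<theta> = (1 / 2) *\<^sub>R \<theta> - 1 *\<^sub>R \<theta>" by (simp add: eq_diff_eq)
    then show ?thesis unfolding scaleR_left_diff_distrib[symmetric] by simp
  qed
  then show ?thesis using \<theta> Ntb by blast
qed

section \<open>Peirce decomposition at an idempotent\<close>

lemma quintic_zero_coeffs:
  fixes c0 c1 c2 c3 c4 c5 :: real
  assumes "\<And>t. c0 + c1 * t + c2 * t^2 + c3 * t^3 + c4 * t^4 + c5 * t^5 = 0"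
  shows "c0 = 0" "c1 = 0" "c2 = 0" "c3 = 0" "c4 = 0" "c5 = 0"
  using assms[of 0] assms[of 1] assms[of "-1"] assms[of 2] assms[of "-2"] assms[of 3]
  by simp_all

text \<open>The cubic is \<open>(x \<star> x) \<bullet> x\<close>. The assumptions
  \<open>peirce\<close> encode the terms of the normal form containing \<open>x_n\<close>, and
  \<open>null\<close> lists the components missing from the remaining cubic. Since the gradient is
  three times \<open>x \<star> x\<close> and the Hessian six times multiplication by
  \<open>x\<close>, the eigencubic equation divided by 54 is \<open>hsiang\<close>.\<close>

locale peirce_decomposition =
  fixes mul :: "'a::euclidean_space \<Rightarrow> 'a \<Rightarrow> 'a" (infixl "\<star>" 70)
    and e :: 'a and V1 V2 V3 :: "'a set" and p1 p2 p3 :: "'a \<Rightarrow> 'a" and \<mu> :: real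
  assumes bil: "bilinear mul"
    and comm: "x \<star> y = y \<star> x"
    and assoc: "(x \<star> y) \<bullet> z = x \<bullet> (y \<star> z)"
    and subspaces: "subspace V1" "subspace V2" "subspace V3"
    and lin: "linear p1" "linear p2" "linear p3"
    and range: "p1 x \<in> V1" "p2 x \<in> V2" "p3 x \<in> V3"
    and proj: "v1 \<in> V1 \<Longrightarrow> p1 x \<bullet> v1 = x \<bullet> v1" "v2 \<in> V2 \<Longrightarrow> p2 x \<bullet> v2 = x \<bullet> v2"
      "v3 \<in> V3 \<Longrightarrow> p3 x \<bullet> v3 = x \<bullet> v3"
    and trace_proj: "(\<Sum>b\<in>Basis. p1 b \<bullet> b) = dim V1" "(\<Sum>b\<in>Basis. p2 b \<bullet> b) = dim V2"
      "(\<Sum>b\<in>Basis. p3 b \<bullet> b) = dim V3"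
    and decomp: "x = (x \<bullet> e) *\<^sub>R e + p1 x + p2 x + p3 x"
    and ee: "e \<bullet> e = 1"
    and orth_e: "v1 \<in> V1 \<Longrightarrow> e \<bullet> v1 = 0" "v2 \<in> V2 \<Longrightarrow> e \<bullet> v2 = 0" "v3 \<in> V3 \<Longrightarrow> e \<bullet> v3 = 0"
    and orth: "v1 \<in> V1 \<Longrightarrow> v2 \<in> V2 \<Longrightarrow> v1 \<bullet> v2 = 0" "v1 \<in> V1 \<Longrightarrow> v3 \<in> V3 \<Longrightarrow> v1 \<bullet> v3 = 0"
      "v2 \<in> V2 \<Longrightarrow> v3 \<in> V3 \<Longrightarrow> v2 \<bullet> v3 = 0"
    and idem: "e \<star> e = e"
    and peirce: "v1 \<in> V1 \<Longrightarrow> e \<star> v1 = - v1" "v2 \<in> V2 \<Longrightarrow> e \<star> v2 = - (1 / 2) *\<^sub>R v2"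
      "v3 \<in> V3 \<Longrightarrow> e \<star> v3 = (1 / 2) *\<^sub>R v3"
    and null: "v1 \<in> V1 \<Longrightarrow> (v1 \<star> v1) \<bullet> v1 = 0"
      "v1 \<in> V1 \<Longrightarrow> v2 \<in> V2 \<Longrightarrow> (v1 \<star> v1) \<bullet> v2 = 0"
      "v1 \<in> V1 \<Longrightarrow> v2 \<in> V2 \<Longrightarrow> (v2 \<star> v2) \<bullet> v1 = 0"
      "v1 \<in> V1 \<Longrightarrow> v3 \<in> V3 \<Longrightarrow> (v1 \<star> v1) \<bullet> v3 = 0"
      "v2 \<in> V2 \<Longrightarrow> v3 \<in> V3 \<Longrightarrow> (v2 \<star> v2) \<bullet> v3 = 0"
      "v3 \<in> V3 \<Longrightarrow> (v3 \<star> v3) \<bullet> v3 = 0"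
    and hsiang: "((x \<star> x) \<bullet> (x \<star> x)) * (\<Sum>b\<in>Basis. (x \<star> b) \<bullet> b) - (x \<star> (x \<star> x)) \<bullet> (x \<star> x)
      = \<mu> * (x \<bullet> x) * ((x \<star> x) \<bullet> x)"
begin

lemmas mul_simps = bilinear_ladd[OF bil] bilinear_radd[OF bil] bilinear_lmul[OF bil]
  bilinear_rmul[OF bil] bilinear_lneg[OF bil] bilinear_rneg[OF bil]
  bilinear_lsub[OF bil] bilinear_rsub[OF bil] bilinear_lzero[OF bil] bilinear_rzero[OF bil]

lemma assoc': "x \<bullet> (y \<star> z) = (x \<star> y) \<bullet> z"
  by (simp add: assoc)

lemma inner_mul_commute: "(x \<star> y) \<bullet> z = (x \<star> z) \<bullet> y"
proof -
  have "(x \<star> y) \<bullet> z = (y \<star> x) \<bullet> z" by (simp only: comm)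
  also have "\<dots> = y \<bullet> (x \<star> z)" by (rule assoc)
  finally show ?thesis by (simp only: inner_commute)
qed

lemma inner_mul_rotate: "(x \<star> y) \<bullet> z = (y \<star> z) \<bullet> x"
  using assoc[of x y z] by (simp only: inner_commute)

text \<open>Up to the factor 6 this is the Laplacian of the cubic.\<close>

definition \<tau> :: "'a \<Rightarrow> real" where "\<tau> x = (\<Sum>b\<in>Basis. (x \<star> b) \<bullet> b)"

lemma \<tau>_lin: "\<tau> (x + y) = \<tau> x + \<tau> y" "\<tau> (c *\<^sub>R x) = c * \<tau> x"
  by (simp_all add: \<tau>_def mul_simps inner_add_left sum.distrib sum_distrib_left)

text \<open>Substituting \<open>t *\<^sub>R e + y\<close> into \<open>hsiang\<close> gives a
  polynomial identity of degree 5 in t. The conclusions are the coefficients of t^5, t^4, t^3 and t,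
  the last one simplified by \<open>\<tau> y = 0\<close>.\<close>

lemma hsiang_expand:
  assumes y: "y \<bullet> e = 0"
  defines "u \<equiv> e \<star> y"
  shows "\<mu> = \<tau> e - 1" "\<tau> y = 0"
    "\<tau> e * (2 * (y \<bullet> u) + 4 * (u \<bullet> u)) - (2 * (y \<bullet> u) + 4 * ((e \<star> u) \<bullet> u) + 4 * (u \<bullet> u))
       = \<mu> * (3 * (y \<bullet> u) + y \<bullet> y)"
    "\<tau> e * ((y \<star> y) \<bullet> (y \<star> y)) - ((e \<star> (y \<star> y)) \<bullet> (y \<star> y) + 4 * ((y \<star> u) \<bullet> (y \<star> y)))
       = \<mu> * (3 * (y \<bullet> y) * (y \<bullet> u))"
proof -
  define w where "w = y \<star> y"
  have u: "u \<bullet> e = 0" "e \<bullet> u = 0"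
    using inner_mul_commute[of e y e] y by (simp_all add: u_def idem inner_commute)
  have we: "w \<bullet> e = y \<bullet> u" "e \<bullet> w = y \<bullet> u"
    using assoc[of y y e] comm[of y e] by (simp_all add: w_def u_def inner_commute)
  have i: "(e \<star> u) \<bullet> e = 0" "(e \<star> w) \<bullet> e = y \<bullet> u" "(y \<star> u) \<bullet> e = u \<bullet> u" "(y \<star> w) \<bullet> e = u \<bullet> w"
    "(e \<star> w) \<bullet> u = (e \<star> u) \<bullet> w" "(y \<star> w) \<bullet> u = (y \<star> u) \<bullet> w"
    using inner_mul_commute[of e u e] inner_mul_commute[of e w e] inner_mul_rotate[of e y u]
      inner_mul_rotate[of e y w] inner_mul_commute[of e w u] inner_mul_commute[of y w u] u we
    by (simp_all add: idem u_def[symmetric] inner_commute)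
  let ?yu = "y \<bullet> u" and ?uu = "u \<bullet> u" and ?T = "\<tau> e" and ?Y = "\<tau> y"
  have poly: "(- (?Y * 0) + ?Y * (w \<bullet> w) - (y \<star> w) \<bullet> w - \<mu> * (y \<bullet> y) * (w \<bullet> y))
    + (?T * (w \<bullet> w) + 4 * ?Y * (u \<bullet> w) - ((e \<star> w) \<bullet> w + 4 * ((y \<star> u) \<bullet> w)) - \<mu> * (3 * (y \<bullet> y) * ?yu)) * t
    + (4 * ?T * (u \<bullet> w) + ?Y * (2 * ?yu + 4 * ?uu) - (4 * ((e \<star> u) \<bullet> w) + 2 * (u \<bullet> w) + 4 * ((y \<star> u) \<bullet> u)) - \<mu> * (w \<bullet> y)) * t^2
    + (?T * (2 * ?yu + 4 * ?uu) - (2 * ?yu + 4 * ((e \<star> u) \<bullet> u) + 4 * ?uu) - \<mu> * (3 * ?yu + y \<bullet> y)) * t^3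
    + ?Y * t^4 + (?T - 1 - \<mu>) * t^5 = 0" for t
  proof -
    let ?x = "t *\<^sub>R e + y"
    have xx: "?x \<star> ?x = t^2 *\<^sub>R e + (2 * t) *\<^sub>R u + w"
    proof -
      have "(2 * t) *\<^sub>R u = t *\<^sub>R u + t *\<^sub>R u" by (simp flip: scaleR_left_distrib)
      then show ?thesis
        by (simp add: mul_simps idem comm[of y e] u_def w_def power2_eq_square scaleR_right_distrib)
    qed
    have xxx: "?x \<star> (t^2 *\<^sub>R e + (2 * t) *\<^sub>R u + w) = t^3 *\<^sub>R e + (2 * t^2) *\<^sub>R (e \<star> u) + t *\<^sub>R (e \<star> w)
        + t^2 *\<^sub>R u + (2 * t) *\<^sub>R (y \<star> u) + y \<star> w"
      by (simp add: mul_simps idem comm[of y e] u_def[symmetric]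
          power2_eq_square power3_eq_cube algebra_simps)
    have n: "(?x \<star> ?x) \<bullet> (?x \<star> ?x) = t^4 + 2 * t^2 * ?yu + 4 * t^2 * ?uu + 4 * t * (u \<bullet> w) + w \<bullet> w"
      unfolding xx using u we ee
      by (simp add: inner_add_left inner_add_right inner_commute[of w u] algebra_simps
          power2_eq_square power4_eq_xxxx)
    have f: "(?x \<star> ?x) \<bullet> ?x = t^3 + 3 * t * ?yu + w \<bullet> y"
      unfolding xx using u we ee y
      by (simp add: inner_add_left inner_add_right inner_commute[of u y] inner_commute[of e y]
          algebra_simps power2_eq_square power3_eq_cube)
    have q: "?x \<bullet> ?x = t^2 + y \<bullet> y"
      using ee y by (simp add: inner_add_left inner_add_right inner_commute[of e y] power2_eq_square)
    have c: "(?x \<star> (?x \<star> ?x)) \<bullet> (?x \<star> ?x) = t^5 + t^3 * (2 * ?yu + 4 * ((e \<star> u) \<bullet> u) + 4 * ?uu)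
        + t^2 * (4 * ((e \<star> u) \<bullet> w) + 2 * (u \<bullet> w) + 4 * ((y \<star> u) \<bullet> u))
        + t * ((e \<star> w) \<bullet> w + 4 * ((y \<star> u) \<bullet> w)) + (y \<star> w) \<bullet> w"
      unfolding xx xxx using u we ee i
      by (simp add: inner_add_left inner_add_right algebra_simps
          power2_eq_square power3_eq_cube power4_eq_xxxx eval_nat_numeral)
    have tx: "(\<Sum>b\<in>Basis. (?x \<star> b) \<bullet> b) = t * ?T + ?Y"
      using \<tau>_lin by (simp add: \<tau>_def[symmetric])
    from hsiang[of ?x] show ?thesis
      unfolding n f q c tx by (simp add: algebra_simps eval_nat_numeral)
  qed
  note cs = quintic_zero_coeffs[OF poly]
  show "\<mu> = \<tau> e - 1" using cs(6) by simp
  show Y: "\<tau> y = 0" by (rule cs(5))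
  show "\<tau> e * (2 * (y \<bullet> u) + 4 * (u \<bullet> u)) - (2 * (y \<bullet> u) + 4 * ((e \<star> u) \<bullet> u) + 4 * (u \<bullet> u))
       = \<mu> * (3 * (y \<bullet> u) + y \<bullet> y)" using cs(4) by simp
  show "\<tau> e * ((y \<star> y) \<bullet> (y \<star> y)) - ((e \<star> (y \<star> y)) \<bullet> (y \<star> y) + 4 * ((y \<star> u) \<bullet> (y \<star> y)))
       = \<mu> * (3 * (y \<bullet> y) * (y \<bullet> u))" using cs(2) Y by (simp add: w_def)
qed


lemma \<tau>_e: "\<tau> e = 1 - real (dim V1) - real (dim V2) / 2 + real (dim V3) / 2"
proof -
  have "(e \<star> b) \<bullet> b = (e \<bullet> b) * (e \<bullet> b) - p1 b \<bullet> b - (p2 b \<bullet> b) / 2 + (p3 b \<bullet> b) / 2" for b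
  proof -
    have "e \<star> b = e \<star> ((b \<bullet> e) *\<^sub>R e + p1 b + p2 b + p3 b)" using decomp[of b] by simp
    also have "\<dots> = (b \<bullet> e) *\<^sub>R e - p1 b - (1 / 2) *\<^sub>R p2 b + (1 / 2) *\<^sub>R p3 b"
      by (simp add: mul_simps idem peirce range)
    finally show ?thesis by (simp add: inner_add_left inner_diff_left inner_commute[of b e])
  qed
  then have "\<tau> e = (\<Sum>b\<in>Basis. (e \<bullet> b) * (e \<bullet> b)) - (\<Sum>b\<in>Basis. p1 b \<bullet> b)
      - (\<Sum>b\<in>Basis. p2 b \<bullet> b) / 2 + (\<Sum>b\<in>Basis. p3 b \<bullet> b) / 2"
    by (simp add: \<tau>_def sum.distrib sum_subtractf sum_divide_distrib)
  moreover have "(\<Sum>b\<in>Basis. (e \<bullet> b) * (e \<bullet> b)) = 1"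
    using euclidean_inner[of e e] ee by simp
  ultimately show ?thesis by (simp add: trace_proj)
qed

section \<open>Multiplication table of the Peirce spaces\<close>

lemma orth_sym:
  "v1 \<in> V1 \<Longrightarrow> v2 \<in> V2 \<Longrightarrow> v2 \<bullet> v1 = 0" "v1 \<in> V1 \<Longrightarrow> v3 \<in> V3 \<Longrightarrow> v3 \<bullet> v1 = 0"
  "v2 \<in> V2 \<Longrightarrow> v3 \<in> V3 \<Longrightarrow> v3 \<bullet> v2 = 0"
  by (subst inner_commute, rule orth, assumption+)+

lemma orth_e_sym:
  "v1 \<in> V1 \<Longrightarrow> v1 \<bullet> e = 0" "v2 \<in> V2 \<Longrightarrow> v2 \<bullet> e = 0" "v3 \<in> V3 \<Longrightarrow> v3 \<bullet> e = 0"
  by (subst inner_commute, erule orth_e)+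

lemma proj_zero:
  "(\<And>v. v \<in> V1 \<Longrightarrow> x \<bullet> v = 0) \<Longrightarrow> p1 x = 0"
  "(\<And>v. v \<in> V2 \<Longrightarrow> x \<bullet> v = 0) \<Longrightarrow> p2 x = 0"
  "(\<And>v. v \<in> V3 \<Longrightarrow> x \<bullet> v = 0) \<Longrightarrow> p3 x = 0"
  by (metis inner_eq_zero_iff proj(1) range(1), metis inner_eq_zero_iff proj(2) range(2),
      metis inner_eq_zero_iff proj(3) range(3))

lemma proj_fix: "v1 \<in> V1 \<Longrightarrow> p1 v1 = v1" "v2 \<in> V2 \<Longrightarrow> p2 v2 = v2" "v3 \<in> V3 \<Longrightarrow> p3 v3 = v3"
proof -
  show "p1 v = v" if "v \<in> V1" for v
    using decomp[of v] proj_zero(2,3)[of v] orth(1,2)[OF that] orth_e_sym(1)[OF that] by simp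
  show "p2 v = v" if "v \<in> V2" for v
    using decomp[of v] proj_zero(1,3)[of v] orth_sym(1)[OF _ that] orth(3)[OF that] orth_e_sym(2)[OF that]
    by simp
  show "p3 v = v" if "v \<in> V3" for v
    using decomp[of v] proj_zero(1,2)[of v] orth_sym(2,3)[OF _ that] orth_e_sym(3)[OF that] by simp
qed

lemma inner_decomp:
  assumes "v1 \<in> V1" "v2 \<in> V2" "v3 \<in> V3" "w1 \<in> V1" "w2 \<in> V2" "w3 \<in> V3"
  shows "(a *\<^sub>R e + v1 + v2 + v3) \<bullet> (b *\<^sub>R e + w1 + w2 + w3)
    = a * b + v1 \<bullet> w1 + v2 \<bullet> w2 + v3 \<bullet> w3"
  using assms by (simp add: inner_add_left inner_add_right ee orth orth_sym orth_e orth_e_sym)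

lemma inner_e_mul: "(x \<star> y) \<bullet> e = (e \<star> x) \<bullet> y"
  by (rule inner_mul_rotate[of e x y, symmetric])

lemma cubic_polarization:
  assumes "subspace V" "\<And>v. v \<in> V \<Longrightarrow> (v \<star> v) \<bullet> v = 0" "v \<in> V" "w \<in> V"
  shows "(v \<star> v) \<bullet> w = 0"
proof -
  have "v + w \<in> V" "v - w \<in> V" using assms by (simp_all add: subspace_add subspace_diff)
  from assms(2)[OF this(1)] assms(2)[OF this(2)] assms(2)[OF assms(3)] assms(2)[OF assms(4)]
  show ?thesis
    by (simp add: mul_simps inner_add_left inner_add_right inner_diff_left inner_diff_right
        comm[of w v] inner_mul_commute[of v w v])
qed

lemma square_polarization:
  assumes "subspace V" "\<And>v. v \<in> V \<Longrightarrow> (v \<star> v) \<bullet> x = 0" "v \<in> V" "w \<in> V"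
  shows "(v \<star> w) \<bullet> x = 0"
  using assms(2)[OF subspace_add[OF assms(1,3,4)]] assms(2)[OF assms(3)] assms(2)[OF assms(4)]
  by (simp add: mul_simps inner_add_left comm[of w v])

lemma null_polarized:
  "a \<in> V1 \<Longrightarrow> b \<in> V1 \<Longrightarrow> c \<in> V1 \<Longrightarrow> (a \<star> b) \<bullet> c = 0"
  "a \<in> V1 \<Longrightarrow> b \<in> V1 \<Longrightarrow> c \<in> V2 \<Longrightarrow> (a \<star> b) \<bullet> c = 0"
  "a \<in> V1 \<Longrightarrow> b \<in> V1 \<Longrightarrow> c \<in> V3 \<Longrightarrow> (a \<star> b) \<bullet> c = 0"
  "a \<in> V2 \<Longrightarrow> b \<in> V2 \<Longrightarrow> c \<in> V1 \<Longrightarrow> (a \<star> b) \<bullet> c = 0"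
  "a \<in> V2 \<Longrightarrow> b \<in> V2 \<Longrightarrow> c \<in> V3 \<Longrightarrow> (a \<star> b) \<bullet> c = 0"
  "a \<in> V3 \<Longrightarrow> b \<in> V3 \<Longrightarrow> c \<in> V3 \<Longrightarrow> (a \<star> b) \<bullet> c = 0"
proof -
  show "a \<in> V1 \<Longrightarrow> b \<in> V1 \<Longrightarrow> c \<in> V1 \<Longrightarrow> (a \<star> b) \<bullet> c = 0"
    by (rule square_polarization[OF subspaces(1)])
      (auto intro: cubic_polarization[OF subspaces(1)] null(1))
  show "a \<in> V3 \<Longrightarrow> b \<in> V3 \<Longrightarrow> c \<in> V3 \<Longrightarrow> (a \<star> b) \<bullet> c = 0"
    by (rule square_polarization[OF subspaces(3)])
      (auto intro: cubic_polarization[OF subspaces(3)] null(6))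
qed (auto intro: square_polarization[OF subspaces(1)] square_polarization[OF subspaces(2)] null(2-5))

lemma null_polarized':
  "a \<in> V1 \<Longrightarrow> b \<in> V2 \<Longrightarrow> c \<in> V1 \<Longrightarrow> (a \<star> b) \<bullet> c = 0"
  "a \<in> V1 \<Longrightarrow> b \<in> V2 \<Longrightarrow> c \<in> V2 \<Longrightarrow> (a \<star> b) \<bullet> c = 0"
  "a \<in> V1 \<Longrightarrow> b \<in> V3 \<Longrightarrow> c \<in> V1 \<Longrightarrow> (a \<star> b) \<bullet> c = 0"
  "a \<in> V2 \<Longrightarrow> b \<in> V3 \<Longrightarrow> c \<in> V2 \<Longrightarrow> (a \<star> b) \<bullet> c = 0"
  using inner_mul_commute[of a b c] inner_mul_rotate[of a b c] null_polarized by auto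

text \<open>In this and the following products, \<open>inner_e_mul\<close> gives the component along
  \<open>e\<close> from the Peirce eigenvalue of a factor, and the vanishing trilinear values delete
  the components that cannot occur.\<close>

lemma mul_11: "a \<in> V1 \<Longrightarrow> b \<in> V1 \<Longrightarrow> a \<star> b = - (a \<bullet> b) *\<^sub>R e"
  using decomp[of "a \<star> b"] proj_zero[of "a \<star> b"] null_polarized(1-3)
  by (simp add: inner_e_mul peirce)

lemma mul_12: "a \<in> V1 \<Longrightarrow> b \<in> V2 \<Longrightarrow> a \<star> b = p3 (a \<star> b)"
  using decomp[of "a \<star> b"] proj_zero(1,2)[of "a \<star> b"] null_polarized'(1,2)
  by (simp add: inner_e_mul peirce orth)

lemma mul_12_mem: "a \<in> V1 \<Longrightarrow> b \<in> V2 \<Longrightarrow> a \<star> b \<in> V3"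
  by (metis mul_12 range(3))

lemma mul_22: "a \<in> V2 \<Longrightarrow> b \<in> V2 \<Longrightarrow> a \<star> b = - ((a \<bullet> b) / 2) *\<^sub>R e + p2 (a \<star> b)"
  using decomp[of "a \<star> b"] proj_zero(1,3)[of "a \<star> b"] null_polarized(4,5)
  by (simp add: inner_e_mul peirce)

lemma mul_13: "a \<in> V1 \<Longrightarrow> b \<in> V3 \<Longrightarrow> a \<star> b = p2 (a \<star> b) + p3 (a \<star> b)"
  using decomp[of "a \<star> b"] proj_zero(1)[of "a \<star> b"] null_polarized'(3)
  by (simp add: inner_e_mul peirce orth)

lemma mul_23: "a \<in> V2 \<Longrightarrow> b \<in> V3 \<Longrightarrow> a \<star> b = p1 (a \<star> b) + p3 (a \<star> b)"
  using decomp[of "a \<star> b"] proj_zero(2)[of "a \<star> b"] null_polarized'(4)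
  by (simp add: inner_e_mul peirce orth)

lemma mul_33: "a \<in> V3 \<Longrightarrow> b \<in> V3 \<Longrightarrow> a \<star> b = ((a \<bullet> b) / 2) *\<^sub>R e + p1 (a \<star> b) + p2 (a \<star> b)"
  using decomp[of "a \<star> b"] proj_zero(3)[of "a \<star> b"] null_polarized(6)
  by (simp add: inner_e_mul peirce)

text \<open>For \<open>y\<close> in \<open>V2\<close> the factor of \<open>\<tau> e\<close> in the
  t^3 coefficient of \<open>hsiang_expand\<close> cancels, so a single nonzero \<open>y\<close>
  determines \<mu>. The t^5 coefficient then gives \<open>\<tau> e = 0\<close>, and the formula for
  this trace becomes the dimension relation.\<close>

lemma trace_data:
  assumes "dim V2 > 0"
  shows "\<mu> = -1" "\<tau> e = 0" "dim V3 + 2 = 2 * dim V1 + dim V2"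
proof -
  have "\<not> V2 \<subseteq> {0}"
    using assms dim_eq_0[of V2, THEN iffD2] by (intro notI) simp_all
  then obtain y where y: "y \<in> V2" "y \<noteq> 0" by blast
  have ye: "y \<bullet> e = 0" using orth_e_sym(2)[OF y(1)] .
  have "(y \<bullet> y) * (\<mu> + 1) = 0"
    using hsiang_expand(3)[OF ye] y(1) by (simp add: peirce mul_simps field_simps)
  then show mu: "\<mu> = -1" using y by simp
  then show te: "\<tau> e = 0" using hsiang_expand(1)[OF ye] by simp
  then have "real (dim V3 + 2) = real (2 * dim V1 + dim V2)" using \<tau>_e by simp
  then show "dim V3 + 2 = 2 * dim V1 + dim V2" by (simp only: of_nat_eq_iff)
qed

end

section \<open>Type (3,8)\<close>

locale peirce_type_3_8 = peirce_decomposition +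
  assumes dim_V1: "dim V1 = 3" and dim_V2: "dim V2 = 8"
begin

section \<open>The quartic identity and the products of the Peirce spaces\<close>

lemma dim_V3: "dim V3 = 12"
  using trace_data(3) dim_V1 dim_V2 by simp

lemma hsiang_linear_part:
  assumes "y \<bullet> e = 0"
  shows "(e \<star> (y \<star> y)) \<bullet> (y \<star> y) + 4 * ((y \<star> (e \<star> y)) \<bullet> (y \<star> y)) = 3 * (y \<bullet> y) * (y \<bullet> (e \<star> y))"
  using hsiang_expand(4)[OF assms] trace_data(1,2) dim_V2 by simp

text \<open>This is \<open>hsiang_linear_part\<close> at \<open>a + b + c\<close>, with both
  products expanded by the multiplication table and sorted by Peirce components. Inserting zeros or
  changing signs of single arguments then isolates identities for the individual products.\<close>

lemma quartic_identity:
  assumes a: "a \<in> V1" and b: "b \<in> V2" and c: "c \<in> V3"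
  shows "p1 (c \<star> c) \<bullet> p1 (c \<star> c) - 4 * (p1 (b \<star> c) \<bullet> p1 (b \<star> c))
      - 5 / 2 * (p2 (b \<star> b) \<bullet> p2 (b \<star> b)) - 8 * (p2 (b \<star> b) \<bullet> p2 (a \<star> c))
      - p2 (b \<star> b) \<bullet> p2 (c \<star> c) - 6 * (p2 (a \<star> c) \<bullet> p2 (a \<star> c))
      + 3 / 2 * (p2 (c \<star> c) \<bullet> p2 (c \<star> c))
      - 10 * ((a \<star> b) \<bullet> (a \<star> b)) - 12 * ((a \<star> b) \<bullet> p3 (a \<star> c)) - 8 * ((a \<star> b) \<bullet> p3 (b \<star> c))
      - 2 * (p3 (a \<star> c) \<bullet> p3 (a \<star> c)) + 2 * (p3 (b \<star> c) \<bullet> p3 (b \<star> c))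
    = (- (a \<bullet> a) - (b \<bullet> b) / 2 + (c \<bullet> c) / 2) * (5 / 2 * (b \<bullet> b) + 3 / 2 * (c \<bullet> c))"
proof -
  define A where "A = p1 (b \<star> c)"
  define P where "P = p1 (c \<star> c)"
  define N where "N = p2 (b \<star> b)"
  define R where "R = p2 (a \<star> c)"
  define S where "S = p2 (c \<star> c)"
  define B where "B = a \<star> b"
  define C where "C = p3 (a \<star> c)"
  define F where "F = p3 (b \<star> c)"
  \<comment> \<open>The component of the square of \<open>a + b + c\<close> along \<open>e\<close>,
    which is also the inner product of \<open>a + b + c\<close> with its product by
    \<open>e\<close>. Hence the right-hand side below is divisible by it.\<close>
  define \<alpha> where "\<alpha> = - (a \<bullet> a) - (b \<bullet> b) / 2 + (c \<bullet> c) / 2"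
  note defs = A_def P_def N_def R_def S_def B_def C_def F_def
  have mem: "A \<in> V1" "P \<in> V1" "N \<in> V2" "R \<in> V2" "S \<in> V2" "B \<in> V3" "C \<in> V3" "F \<in> V3"
    using a b by (simp_all add: defs range mul_12_mem)
  have prods: "a \<star> a = - (a \<bullet> a) *\<^sub>R e" "a \<star> b = B" "b \<star> b = - ((b \<bullet> b) / 2) *\<^sub>R e + N"
    "a \<star> c = R + C" "b \<star> c = A + F" "c \<star> c = ((c \<bullet> c) / 2) *\<^sub>R e + P + S"
    "b \<star> a = B" "c \<star> a = R + C" "c \<star> b = A + F"
    using mul_11[OF a a] mul_22[OF b b] mul_13[OF a c] mul_23[OF b c] mul_33[OF c c]
      comm[of b a] comm[of c a] comm[of c b] by (simp_all add: defs)
  let ?y = "a + b + c"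
  have yy: "?y \<star> ?y = \<alpha> *\<^sub>R e + (2 *\<^sub>R A + P) + (N + 2 *\<^sub>R R + S) + 2 *\<^sub>R (B + C + F)"
    by (simp add: mul_simps prods \<alpha>_def scaleR_2 algebra_simps)
  have eyy: "e \<star> (?y \<star> ?y) = \<alpha> *\<^sub>R e + - (2 *\<^sub>R A + P) + - (1 / 2) *\<^sub>R (N + 2 *\<^sub>R R + S) + (B + C + F)"
    unfolding yy by (simp add: mul_simps idem peirce mem algebra_simps)
  have ey: "e \<star> ?y = - a - (1 / 2) *\<^sub>R b + (1 / 2) *\<^sub>R c"
    using a b c by (simp add: mul_simps peirce)
  have yey: "?y \<star> (e \<star> ?y) = (a \<bullet> a + (b \<bullet> b) / 4 + (c \<bullet> c) / 4) *\<^sub>R e + (1 / 2) *\<^sub>R P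
      + (- (1 / 2) *\<^sub>R N - (1 / 2) *\<^sub>R R + (1 / 2) *\<^sub>R S) + (- (3 / 2) *\<^sub>R B - (1 / 2) *\<^sub>R C)"
  proof -
    have B: "- (3 / 2) *\<^sub>R B = - B - (1 / 2) *\<^sub>R B"
      using scaleR_left_distrib[of "-1" "- (1 / 2)" B] by simp
    have R: "- (1 / 2) *\<^sub>R R = (1 / 2) *\<^sub>R R - R" "- (1 / 2) *\<^sub>R C = (1 / 2) *\<^sub>R C - C"
      using scaleR_left_diff_distrib[of "1 / 2" 1 R] scaleR_left_diff_distrib[of "1 / 2" 1 C] by simp_all
    show ?thesis
      unfolding ey B using R by (simp add: mul_simps prods algebra_simps)
  qed
  have ye: "?y \<bullet> e = 0" using a b c by (simp add: inner_add_left orth_e_sym)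
  have lhs1: "(e \<star> (?y \<star> ?y)) \<bullet> (?y \<star> ?y) = \<alpha> * \<alpha> + - (2 *\<^sub>R A + P) \<bullet> (2 *\<^sub>R A + P)
      + (- (1 / 2) *\<^sub>R (N + 2 *\<^sub>R R + S)) \<bullet> (N + 2 *\<^sub>R R + S) + (B + C + F) \<bullet> (2 *\<^sub>R (B + C + F))"
    unfolding eyy unfolding yy
    by (rule inner_decomp; intro subspace_add subspace_scale subspace_neg subspaces mem)
  have lhs2: "(?y \<star> (e \<star> ?y)) \<bullet> (?y \<star> ?y) = (a \<bullet> a + (b \<bullet> b) / 4 + (c \<bullet> c) / 4) * \<alpha>
      + (1 / 2) *\<^sub>R P \<bullet> (2 *\<^sub>R A + P)
      + (- (1 / 2) *\<^sub>R N - (1 / 2) *\<^sub>R R + (1 / 2) *\<^sub>R S) \<bullet> (N + 2 *\<^sub>R R + S)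
      + (- (3 / 2) *\<^sub>R B - (1 / 2) *\<^sub>R C) \<bullet> (2 *\<^sub>R (B + C + F))"
    unfolding yey unfolding yy
    by (rule inner_decomp; intro subspace_add subspace_diff subspace_scale subspace_neg subspaces mem)
  have rhs: "?y \<bullet> ?y = a \<bullet> a + b \<bullet> b + c \<bullet> c" "?y \<bullet> (e \<star> ?y) = \<alpha>"
    unfolding ey using a b c
    by (simp_all add: inner_add_left inner_add_right inner_diff_right orth orth_sym \<alpha>_def)
  have "P \<bullet> P - 4 * (A \<bullet> A) - 5 / 2 * (N \<bullet> N) - 8 * (N \<bullet> R) - N \<bullet> S - 6 * (R \<bullet> R)
      + 3 / 2 * (S \<bullet> S) - 10 * (B \<bullet> B) - 12 * (B \<bullet> C) - 8 * (B \<bullet> F) - 2 * (C \<bullet> C) + 2 * (F \<bullet> F)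
      = 3 * (a \<bullet> a + b \<bullet> b + c \<bullet> c) * \<alpha> - \<alpha> * \<alpha> - 4 * ((a \<bullet> a + (b \<bullet> b) / 4 + (c \<bullet> c) / 4) * \<alpha>)"
    using hsiang_linear_part[OF ye] unfolding lhs1 lhs2 rhs
    by (simp add: inner_add_left inner_add_right inner_diff_left inner_commute[of P A]
        inner_commute[of R N] inner_commute[of S N] inner_commute[of S R] inner_commute[of C B]
        inner_commute[of F B] inner_commute[of F C] field_simps)
  also have "\<dots> = \<alpha> * (5 / 2 * (b \<bullet> b) + 3 / 2 * (c \<bullet> c))"
    by (simp add: \<alpha>_def field_simps)
  finally show ?thesis by (simp only: defs \<alpha>_def)
qed


lemma zero_mem: "0 \<in> V1" "0 \<in> V2" "0 \<in> V3"
  using subspaces by (simp_all add: subspace_0)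

lemma proj_0: "p1 0 = 0" "p2 0 = 0" "p3 0 = 0"
  using lin by (simp_all add: linear_0)

lemma proj_neg: "p1 (- x) = - p1 x" "p2 (- x) = - p2 x" "p3 (- x) = - p3 x"
  using lin by (simp_all add: linear_neg)

text \<open>The eiconal equation for the restriction of the cubic to \<open>V2\<close>, that is, for
  \<psi>030.\<close>

lemma norm_V2_square: "b \<in> V2 \<Longrightarrow> p2 (b \<star> b) \<bullet> p2 (b \<star> b) = (b \<bullet> b)\<^sup>2 / 2"
  using quartic_identity[OF zero_mem(1) _ zero_mem(3), of b]
  by (simp add: mul_simps proj_0 power2_eq_square)

lemma norm_V1_V2: "a \<in> V1 \<Longrightarrow> b \<in> V2 \<Longrightarrow> (a \<star> b) \<bullet> (a \<star> b) = (a \<bullet> a) * (b \<bullet> b) / 4"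
  using quartic_identity[OF _ _ zero_mem(3), of a b] norm_V2_square[of b]
  by (simp add: mul_simps proj_0 power2_eq_square field_simps)

lemma norm_V3_square:
  "c \<in> V3 \<Longrightarrow> p1 (c \<star> c) \<bullet> p1 (c \<star> c) + 3 / 2 * (p2 (c \<star> c) \<bullet> p2 (c \<star> c)) = 3 / 4 * (c \<bullet> c)\<^sup>2"
  using quartic_identity[OF zero_mem(1,2), of c]
  by (simp add: mul_simps proj_0 power2_eq_square)

lemma norm_V1_V3:
  "a \<in> V1 \<Longrightarrow> c \<in> V3 \<Longrightarrow>
   3 * (p2 (a \<star> c) \<bullet> p2 (a \<star> c)) + p3 (a \<star> c) \<bullet> p3 (a \<star> c) = 3 / 4 * (a \<bullet> a) * (c \<bullet> c)"
  using quartic_identity[OF _ zero_mem(2), of a c] norm_V3_square[of c]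
  by (simp add: mul_simps proj_0 power2_eq_square field_simps)

text \<open>The only term of the quartic identity that is odd in \<open>b\<close> is the one with
  \<open>(a \<star> b) \<bullet> p3 (a \<star> c)\<close>; comparing \<open>b\<close> with
  \<open>- b\<close> isolates it.\<close>

lemma V1_V2_orth_V1_V3:
  assumes a: "a \<in> V1" and b: "b \<in> V2" and c: "c \<in> V3"
  shows "(a \<star> b) \<bullet> (a \<star> c) = 0"
proof -
  have "- b \<in> V2" using b subspaces(2) by (simp add: subspace_neg)
  from quartic_identity[OF a b c] quartic_identity[OF a this c]
  have "(a \<star> b) \<bullet> p3 (a \<star> c) = 0"
    by (simp add: mul_simps proj_neg)
  then show ?thesis
    using proj(3)[OF mul_12_mem[OF a b], of "a \<star> c"] by (simp add: inner_commute)
qed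

text \<open>The two products in the sum come from the terms of the quartic identity that are odd in
  \<open>a\<close>, and they carry the same coefficient -8.\<close>

lemma V2_square_V1_V3:
  assumes a: "a \<in> V1" and b: "b \<in> V2" and c: "c \<in> V3"
  shows "p2 (b \<star> b) \<bullet> (a \<star> c) + (a \<star> b) \<bullet> (b \<star> c) = 0"
proof -
  have "- a \<in> V1" using a subspaces(1) by (simp add: subspace_neg)
  from quartic_identity[OF a b c] quartic_identity[OF this b c]
  have "p2 (b \<star> b) \<bullet> p2 (a \<star> c) + (a \<star> b) \<bullet> p3 (b \<star> c) = 0"
    by (simp add: mul_simps proj_neg)
  then show ?thesis
    using proj(3)[OF mul_12_mem[OF a b], of "b \<star> c"] proj(2)[OF range(2), of "a \<star> c" "b \<star> b"]
    by (simp add: inner_commute)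
qed

lemma inner_V1_V2_V1_V2:
  assumes "a \<in> V1" "b \<in> V2" "b' \<in> V2"
  shows "(a \<star> b) \<bullet> (a \<star> b') = (a \<bullet> a) * (b \<bullet> b') / 4"
  using norm_V1_V2[OF assms(1) subspace_add[OF subspaces(2) assms(2,3)]]
    norm_V1_V2[OF assms(1,2)] norm_V1_V2[OF assms(1,3)]
  by (simp add: mul_simps inner_add_left inner_add_right inner_commute[of b' b]
      inner_commute[of "a \<star> b'" "a \<star> b"] field_simps)

lemma inner_V1_V2_V1_V2':
  assumes "a \<in> V1" "a' \<in> V1" "b \<in> V2" "b' \<in> V2"
  shows "(a \<star> b) \<bullet> (a' \<star> b') + (a' \<star> b) \<bullet> (a \<star> b') = (a \<bullet> a') * (b \<bullet> b') / 2"
  using inner_V1_V2_V1_V2[OF subspace_add[OF subspaces(1) assms(1,2)] assms(3,4)]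
    inner_V1_V2_V1_V2[OF assms(1,3,4)] inner_V1_V2_V1_V2[OF assms(2,3,4)]
  by (simp add: mul_simps inner_add_left inner_add_right inner_commute[of a' a] field_simps)

lemma V1_V2_orth_V1_V3':
  assumes "a \<in> V1" "a' \<in> V1" "b \<in> V2" "c \<in> V3"
  shows "(a \<star> b) \<bullet> (a' \<star> c) + (a' \<star> b) \<bullet> (a \<star> c) = 0"
  using V1_V2_orth_V1_V3[OF subspace_add[OF subspaces(1) assms(1,2)] assms(3,4)]
    V1_V2_orth_V1_V3[OF assms(1,3,4)] V1_V2_orth_V1_V3[OF assms(2,3,4)]
  by (simp add: mul_simps inner_add_left inner_add_right)

lemma V1_V1_V2:
  assumes a: "a \<in> V1" and b: "b \<in> V2"
  shows "a \<star> (a \<star> b) = ((a \<bullet> a) / 4) *\<^sub>R b"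
proof -
  have c: "a \<star> b \<in> V3" by (rule mul_12_mem[OF a b])
  have "p3 (a \<star> (a \<star> b)) = 0"
  proof (rule proj_zero(3))
    show "(a \<star> (a \<star> b)) \<bullet> v = 0" if "v \<in> V3" for v
      using V1_V2_orth_V1_V3[OF a b that] inner_mul_commute[of a "a \<star> b" v]
      by (simp add: inner_commute)
  qed
  moreover have "p2 (a \<star> (a \<star> b)) = ((a \<bullet> a) / 4) *\<^sub>R b"
  proof -
    let ?d = "p2 (a \<star> (a \<star> b)) - ((a \<bullet> a) / 4) *\<^sub>R b"
    have "?d \<bullet> x = 0" if x: "x \<in> V2" for x
      using proj(2)[OF x, of "a \<star> (a \<star> b)"] inner_V1_V2_V1_V2[OF a b x]
        inner_mul_commute[of a "a \<star> b" x] inner_commute[of "a \<star> x" "a \<star> b"]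
      by (simp add: inner_diff_left)
    moreover have "?d \<in> V2"
      using b by (intro subspace_diff subspace_scale subspaces range)
    ultimately have "?d \<bullet> ?d = 0" by blast
    then show ?thesis by simp
  qed
  ultimately show ?thesis using mul_13[OF a c] by simp
qed

text \<open>Compressed to the image \<open>a \<star> V2\<close>, multiplication by \<open>b\<close>
  is a negative multiple of the product of \<open>V2\<close> itself. With all of
  \<open>V2_square_V1_V3\<close> restricted to \<open>c = a \<star> z\<close>, this holds when the
  first two arguments coincide; the general case is a polarisation.\<close>

lemma V2_on_V1_V2:
  assumes a: "a \<in> V1" and b: "b \<in> V2" "b' \<in> V2" "b'' \<in> V2"
  shows "(b \<star> (a \<star> b')) \<bullet> (a \<star> b'') = - ((a \<bullet> a) / 4) * ((b \<star> b') \<bullet> b'')"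
proof -
  define T where "T x y z = (x \<star> (a \<star> y)) \<bullet> (a \<star> z)" for x y z
  define \<Phi> where "\<Phi> x y z = ((a \<bullet> a) / 4) * ((x \<star> y) \<bullet> z)" for x y z
  have sym: "T x y z = T x z y" for x y z
    unfolding T_def by (rule inner_mul_commute)
  have diag: "T x x z = - \<Phi> x x z" if "x \<in> V2" "z \<in> V2" for x z
  proof -
    have "p2 (x \<star> x) \<bullet> (a \<star> (a \<star> z)) = \<Phi> x x z"
      using V1_V1_V2[OF a that(2)] proj(2)[OF that(2), of "x \<star> x"] by (simp add: \<Phi>_def)
    moreover have "(a \<star> x) \<bullet> (x \<star> (a \<star> z)) = T x x z"
      unfolding T_def assoc' by (simp add: comm)
    ultimately show ?thesis using V2_square_V1_V3[OF a that(1) mul_12_mem[OF a that(2)]] by simp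
  qed
  have pol: "T x y z + T y x z = - 2 * \<Phi> x y z" if "x \<in> V2" "y \<in> V2" "z \<in> V2" for x y z
    using diag[OF subspace_add[OF subspaces(2) that(1,2)] that(3)] diag[OF that(1,3)] diag[OF that(2,3)]
    by (simp add: T_def \<Phi>_def mul_simps inner_add_left comm[of y x] field_simps)
  have \<Phi>: "\<Phi> y z x = \<Phi> x y z" "\<Phi> z x y = \<Phi> x y z" for x y z
    using inner_mul_rotate[of x y z] inner_mul_rotate[of z x y] by (simp_all add: \<Phi>_def)
  \<comment> \<open>As \<open>T\<close> is symmetric in its last two arguments, only three values of
    it occur. The three cyclic instances of \<open>pol\<close> give their pairwise sums, all equal
    because \<Phi> is totally symmetric.\<close>
  have "T b b' b'' = - \<Phi> b b' b''"
    using pol[OF b] pol[OF b(2,3,1)] pol[OF b(3,1,2)] sym[of b b'' b'] sym[of b' b'' b]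
      sym[of b'' b b'] \<Phi>(1)[of b b' b''] \<Phi>(2)[of b b' b''] by linarith
  then show ?thesis by (simp add: T_def \<Phi>_def)
qed

lemma V2_on_V1_V2':
  assumes "a \<in> V1" "a' \<in> V1" "b \<in> V2" "b' \<in> V2" "b'' \<in> V2"
  shows "(b \<star> (a \<star> b')) \<bullet> (a' \<star> b'') + (b \<star> (a' \<star> b')) \<bullet> (a \<star> b'')
    = - ((a \<bullet> a') / 2) * ((b \<star> b') \<bullet> b'')"
  using V2_on_V1_V2[OF subspace_add[OF subspaces(1) assms(1,2)] assms(3-5)]
    V2_on_V1_V2[OF assms(1,3-5)] V2_on_V1_V2[OF assms(2,3-5)]
  by (simp add: mul_simps inner_add_left inner_add_right inner_commute[of a' a] field_simps)


section \<open>A large subspace of \<open>V2\<close> on which the cubic vanishes\<close>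

lemma subspace_orth_image: "subspace {z \<in> V3. \<forall>x\<in>V2. (a \<star> x) \<bullet> z = 0}"
  using subspaces(3) by (auto simp: subspace_def inner_right_distrib)

lemma linear_mul: "linear (\<lambda>x. a \<star> x)"
  by (rule linearI) (simp_all add: mul_simps)

lemma dim_orth_image:
  assumes a: "a \<in> V1" "a \<bullet> a = 1"
  shows "dim {z \<in> V3. \<forall>x\<in>V2. (a \<star> x) \<bullet> z = 0} = 4"
proof -
  let ?W = "(\<lambda>x. a \<star> x) ` V2"
  have "inj_on (\<lambda>x. a \<star> x) V2"
  proof (rule inj_onI)
    fix x y assume xy: "x \<in> V2" "y \<in> V2" "a \<star> x = a \<star> y"
    have "x - y \<in> V2" "a \<star> (x - y) = 0"
      using xy subspaces(2) by (simp_all add: mul_simps subspace_diff)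
    then show "x = y" using norm_V1_V2[OF a(1), of "x - y"] a(2) by simp
  qed
  then have "dim ?W = 8"
    using dim_image_eq[of "\<lambda>x. a \<star> x" V2] linear_mul dim_V2 subspaces(2)
    by (simp add: span_eq_iff[THEN iffD2])
  moreover have "dim {z \<in> V3. \<forall>y\<in>?W. orthogonal y z} + dim ?W = dim V3"
    using linear_subspace_image[OF linear_mul subspaces(2)] subspaces(3) mul_12_mem[OF a(1)]
    by (intro dim_subspace_orthogonal_to_vectors) auto
  ultimately show ?thesis using dim_V3 by (simp add: orthogonal_def)
qed

text \<open>On the complement of \<open>a \<star> V2\<close> multiplication by \<open>a\<close> has
  no component in \<open>V2\<close>, so \<open>norm_V1_V3\<close> makes it a similarity with squared
  ratio 3/4. Being self-adjoint, it squares to 3/4.\<close>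

lemma involution_on_orth_image:
  assumes a: "a \<in> V1" "a \<bullet> a = 1"
  defines "E \<equiv> {z \<in> V3. \<forall>x\<in>V2. (a \<star> x) \<bullet> z = 0}"
  assumes z: "z \<in> E"
  shows "a \<star> z \<in> E" "a \<star> (a \<star> z) = (3 / 4) *\<^sub>R z"
proof -
  have p2: "p2 (a \<star> w) = 0" if "w \<in> E" for w
    using that inner_mul_commute[of a w] by (intro proj_zero(2)) (auto simp: E_def)
  have V3: "a \<star> w \<in> V3" if "w \<in> E" for w
    using mul_13[OF a(1), of w] p2[OF that] range(3)[of "a \<star> w"] that by (simp add: E_def)
  have mem: "a \<star> w \<in> E" if "w \<in> E" for w
  proof -
    have "w \<in> V3" using that by (simp add: E_def)
    then show ?thesis using V1_V2_orth_V1_V3[OF a(1)] V3[OF that] by (simp add: E_def)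
  qed
  show "a \<star> z \<in> E" by (rule mem[OF z])
  have sE: "subspace E" unfolding E_def by (rule subspace_orth_image)
  have norm: "(a \<star> w) \<bullet> (a \<star> w) = 3 / 4 * (w \<bullet> w)" if "w \<in> E" for w
    using norm_V1_V3[OF a(1), of w] p2[OF that] proj_fix(3)[OF V3[OF that]] that a(2)
    by (simp add: E_def)
  let ?d = "a \<star> (a \<star> z) - (3 / 4) *\<^sub>R z"
  have "?d \<bullet> w = 0" if w: "w \<in> E" for w
  proof -
    have "(a \<star> z) \<bullet> (a \<star> w) = 3 / 4 * (z \<bullet> w)"
      using norm[OF subspace_add[OF sE z w]] norm[OF z] norm[OF w]
      by (simp add: mul_simps inner_add_left inner_add_right inner_commute[of w z]
          inner_commute[of "a \<star> w" "a \<star> z"])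
    then show ?thesis
      using inner_mul_commute[of a "a \<star> z" w] inner_commute[of "a \<star> w" "a \<star> z"]
      by (simp add: inner_diff_left)
  qed
  moreover have "?d \<in> E" using mem[OF mem[OF z]] sE z by (intro subspace_diff subspace_scale)
  ultimately have "?d \<bullet> ?d = 0" by blast
  then show "a \<star> (a \<star> z) = (3 / 4) *\<^sub>R z" by simp
qed

lemma ex_large_subspace:
  assumes a: "a \<in> V1" "a \<bullet> a = 1" and b: "b \<in> V1"
  shows "\<exists>K. subspace K \<and> K \<subseteq> V2 \<and> 6 \<le> dim K \<and> (\<forall>x\<in>K. \<exists>y\<in>V2. b \<star> x = a \<star> y)"
proof -
  \<comment> \<open>The only possible eigenvalues of multiplication by \<open>a\<close> on
    \<open>E\<close> are \<open>s\<close> and \<open>- s\<close>.\<close>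
  define s where "s = sqrt 3 / 2"
  have s: "s * s = 3 / 4" "s \<noteq> 0" by (simp_all add: s_def)
  define E where "E = {z \<in> V3. \<forall>x\<in>V2. (a \<star> x) \<bullet> z = 0}"
  have sE: "subspace E" unfolding E_def by (rule subspace_orth_image)
  note inv = involution_on_orth_image[OF a, folded E_def]
  define G where "G t = {z \<in> E. a \<star> z = t *\<^sub>R z}" for t
  have sG: "subspace (G t)" for t
    using sE by (auto simp: G_def subspace_def mul_simps scaleR_right_distrib)
  have orthG: "z \<bullet> w = 0" if "z \<in> G s" "w \<in> G (- s)" for z w
    using that inner_mul_commute[of a z w] s(2)
    by (auto simp: G_def inner_commute[of w z])
  have "dim (G s) + dim (G (- s)) \<le> dim E"
  proof -
    have "{x + y |x y. x \<in> G s \<and> y \<in> G (- s)} \<subseteq> E"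
      using sE by (auto simp: G_def subspace_add)
    from dim_subset[OF this] show ?thesis
      using dim_sums_orthogonal[OF sG[of s] sG[of "- s"] orthG] by simp
  qed
  then have "dim (G s) \<le> 2 \<or> dim (G (- s)) \<le> 2"
    using dim_orth_image[OF a, folded E_def] by linarith
  then obtain t where t: "t * t = 3 / 4" "t \<noteq> 0" "dim (G t) \<le> 2"
  proof
    assume "dim (G s) \<le> 2"
    then show thesis using s by (intro that)
  next
    assume "dim (G (- s)) \<le> 2"
    then show thesis using s by (intro that) simp_all
  qed
  obtain B where B: "B \<subseteq> G t" "independent B" "G t \<subseteq> span B" "card B = dim (G t)"
    using basis_exists[of "G t"] by blast
  \<comment> \<open>By self-adjointness, orthogonality of \<open>x\<close> to \<open>F\<close> means
    that \<open>b \<star> x\<close> is orthogonal to the smaller eigenspace \<open>G t\<close>. This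
    costs at most two dimensions.\<close>
  define F where "F = (\<lambda>f. b \<star> f) ` B"
  have finF: "finite F" using independent_imp_finite[OF B(2)] by (simp add: F_def)
  have cardF: "card F \<le> 2"
    using card_image_le[OF independent_imp_finite[OF B(2)], of "\<lambda>f. b \<star> f"] B(4) t(3)
    by (simp add: F_def)
  define K where "K = {x \<in> V2. \<forall>f\<in>F. f \<bullet> x = 0}"
  have sK: "subspace K" using subspaces(2) by (auto simp: K_def subspace_def inner_right_distrib)
  have dK: "6 \<le> dim K" using dim_orthogonal_Int[OF subspaces(2) finF] cardF dim_V2 by (simp add: K_def)
  have "\<exists>y\<in>V2. b \<star> x = a \<star> y" if x: "x \<in> K" for x
  proof -
    have xV: "x \<in> V2" using x by (simp add: K_def)
    define \<zeta> where "\<zeta> = b \<star> x"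
    have \<zeta>: "\<zeta> \<in> V3" unfolding \<zeta>_def by (rule mul_12_mem[OF b xV])
    \<comment> \<open>The factor 4 makes \<open>a \<star> y\<close> the orthogonal projection of
      \<zeta> to \<open>a \<star> V2\<close>, as multiplication by \<open>a\<close> scales inner
      products on \<open>V2\<close> by 1/4. The remainder \<open>w\<close> is therefore the part of
      \<zeta> in \<open>E\<close>, which has to vanish.\<close>
    define y where "y = 4 *\<^sub>R p2 (a \<star> \<zeta>)"
    have y: "y \<in> V2" unfolding y_def using subspaces(2) range(2) by (simp add: subspace_scale)
    define w where "w = \<zeta> - a \<star> y"
    have ay: "a \<star> y \<in> V3" by (rule mul_12_mem[OF a(1) y])
    have wE: "w \<in> E"
    proof -
      have "(a \<star> v) \<bullet> w = 0" if v: "v \<in> V2" for v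
        using inner_V1_V2_V1_V2[OF a(1) v y] a(2) proj(2)[OF v, of "a \<star> \<zeta>"]
          inner_mul_commute[of a \<zeta> v]
        by (simp add: w_def y_def inner_diff_right inner_commute[of v])
      moreover have "w \<in> V3" unfolding w_def using \<zeta> ay subspaces(3) by (simp add: subspace_diff)
      ultimately show ?thesis by (simp add: E_def)
    qed
    have G\<zeta>: "\<zeta> \<bullet> z = 0" if "z \<in> G t" for z
    proof -
      have "z \<in> span B" using that B(3) by blast
      then have "x \<bullet> (b \<star> z) = 0"
      proof (induction rule: span_induct_alt)
        case base show ?case by (simp add: mul_simps)
      next
        case (step c f z)
        have "(b \<star> f) \<bullet> x = 0" using x step(1) by (simp add: K_def F_def)
        then show ?case using step(2) by (simp add: mul_simps inner_add_right inner_commute)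
      qed
      then show ?thesis using inner_mul_commute[of b x z] by (simp add: \<zeta>_def inner_commute)
    qed
    have "(a \<star> \<zeta>) \<bullet> \<zeta> = 0"
    proof -
      \<comment> \<open>Polarised orthogonality exchanges \<open>a\<close> and \<open>b\<close>
        here: \<open>b \<star> \<zeta>\<close> is a multiple of \<open>x\<close>, hence in
        \<open>V2\<close>, whereas \<open>a \<star> x\<close> is in \<open>V3\<close>.\<close>
      have "(a \<star> x) \<bullet> (b \<star> \<zeta>) = 0"
        using V1_V1_V2[OF b xV] orth_sym(3)[OF xV mul_12_mem[OF a(1) xV]] by (simp add: \<zeta>_def)
      then show ?thesis
        using V1_V2_orth_V1_V3'[OF a(1) b xV \<zeta>] by (simp add: \<zeta>_def inner_commute)
    qed
    moreover have "a \<star> (a \<star> y) = (1 / 4) *\<^sub>R y" using V1_V1_V2[OF a(1) y] a(2) by simp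
    moreover have "(a \<star> \<zeta>) \<bullet> (a \<star> y) = (a \<star> (a \<star> y)) \<bullet> \<zeta>" 
      by (rule inner_mul_commute)
    ultimately have aww: "(a \<star> w) \<bullet> w = 0"
      using orth(3)[OF y \<zeta>] orth(3)[OF y ay]
      by (simp add: w_def mul_simps inner_diff_left inner_diff_right)
    \<comment> \<open>Twice the projection of \<open>w\<close> to the eigenspace \<open>G t\<close>.
      It is orthogonal to \<open>w\<close> by the choice of \<open>K\<close>, and since
      \<open>(a \<star> w) \<bullet> w = 0\<close>, this says that \<open>w\<close> has length
      zero.\<close>
    define z where "z = w + (1 / t) *\<^sub>R (a \<star> w)"
    have "z \<in> G t"
    proof -
      have "a \<star> z = a \<star> w + (1 / t) *\<^sub>R ((t * t) *\<^sub>R w)"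
        unfolding t(1) inv(2)[OF wE, symmetric] by (simp add: z_def mul_simps)
      also have "\<dots> = t *\<^sub>R z" using t(2) by (simp add: z_def scaleR_right_distrib add.commute)
      finally show ?thesis
        using inv(1)[OF wE] wE sE by (simp add: G_def z_def subspace_add subspace_scale)
    qed
    then have "\<zeta> \<bullet> z = 0" "(a \<star> y) \<bullet> z = 0"
      using G\<zeta> y by (auto simp: G_def E_def)
    then have "w \<bullet> z = 0" by (simp add: w_def inner_diff_left)
    then have "w \<bullet> w = 0" using aww by (simp add: z_def inner_add_right inner_commute)
    then have "\<zeta> = a \<star> y" by (simp add: w_def)
    then show ?thesis using y by (auto simp: \<zeta>_def)
  qed
  then show ?thesis using sK dK by (intro exI[of _ K]) (auto simp: K_def)
qed

text \<open>The partial map taking \<open>x\<close> to \<open>x'\<close> with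
  \<open>b \<star> x = a \<star> x'\<close> behaves like a complex structure: it squares to -1 and
  is skew with respect to the trilinear form of the cubic in any two arguments. The three skewness
  relations for a triple leave no nonzero value.\<close>

lemma null_triple:
  assumes a: "a \<in> V1" "a \<bullet> a = 1" and b: "b \<in> V1" "b \<bullet> b = 1" and ab: "a \<bullet> b = 0"
    and x: "x \<in> V2" "x' \<in> V2" "b \<star> x = a \<star> x'"
    and y: "y \<in> V2" "y' \<in> V2" "b \<star> y = a \<star> y'"
    and z: "z \<in> V2" "z' \<in> V2" "b \<star> z = a \<star> z'"
  shows "(x \<star> y) \<bullet> z = 0"
proof -
  \<comment> \<open>The graph of this map; a relation, because the map need not be defined on all of
    \<open>V2\<close>.\<close>
  define Q where "Q u v \<longleftrightarrow> u \<in> V2 \<and> v \<in> V2 \<and> b \<star> u = a \<star> v" for u v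
  have move: "(w \<star> u) \<bullet> v' + (w \<star> u') \<bullet> v = 0" if w: "w \<in> V2" and u: "Q u u'" and v: "Q v v'" for w u u' v v'
  proof -
    have "(w \<star> (a \<star> u)) \<bullet> (a \<star> v') + (w \<star> (a \<star> u')) \<bullet> (a \<star> v) = 0"
      using V2_on_V1_V2'[OF a(1) b(1) w, of u v] u v ab by (simp add: Q_def)
    then show ?thesis
      using V2_on_V1_V2[OF a(1) w, of u v'] V2_on_V1_V2[OF a(1) w, of u' v] u v a(2)
      by (simp add: Q_def)
  qed
  have turn: "Q v (- u)" if "Q u v" for u v
  proof -
    have uv: "u \<in> V2" "v \<in> V2" "b \<star> u = a \<star> v" using that by (simp_all add: Q_def)
    have "u \<bullet> u = v \<bullet> v"
      using norm_V1_V2[OF a(1) uv(2)] norm_V1_V2[OF b(1) uv(1)] a(2) b(2) uv(3) by simp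
    moreover have "(b \<star> v) \<bullet> (a \<star> u) = - ((a \<star> v) \<bullet> (b \<star> u))"
      using inner_V1_V2_V1_V2'[OF a(1) b(1) uv(2,1)] ab by simp
    ultimately have "(b \<star> v + a \<star> u) \<bullet> (b \<star> v + a \<star> u) = 0"
      using norm_V1_V2[OF b(1) uv(2)] norm_V1_V2[OF a(1) uv(1)] norm_V1_V2[OF b(1) uv(1)] a(2) b(2) uv(3)
      by (simp add: inner_add_left inner_add_right inner_commute[of "a \<star> u" "b \<star> v"])
    then show ?thesis
      using uv subspaces(2) by (simp add: Q_def subspace_neg mul_simps add_eq_0_iff2)
  qed
  have zero: "(u' \<star> v) \<bullet> w = 0" if "Q u u'" "Q v v'" "Q w w'" for u u' v v' w w'
  proof -
    have V: "u \<in> V2" "v \<in> V2" "w \<in> V2" using that by (simp_all add: Q_def)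
    have "(w \<star> u') \<bullet> v + (w \<star> u) \<bullet> v' = 0" using move[OF V(3) that(1,2)] by simp
    moreover have "(u \<star> v') \<bullet> w + (u \<star> v) \<bullet> w' = 0" using move[OF V(1) that(2,3)] by simp
    moreover have "(v \<star> u) \<bullet> w' + (v \<star> u') \<bullet> w = 0" using move[OF V(2) that(1,3)] by simp
    moreover have "(w \<star> u') \<bullet> v = (u' \<star> v) \<bullet> w" "(w \<star> u) \<bullet> v' = (u \<star> v') \<bullet> w"
      by (simp_all only: inner_mul_rotate[of w])
    ultimately show ?thesis by (simp add: comm[of v])
  qed
  have Q: "Q x x'" "Q y y'" "Q z z'" using x y z by (simp_all add: Q_def)
  \<comment> \<open>Since \<open>zero\<close> controls products with one primed argument, it is
    applied to \<open>x'\<close>, whose own partner is \<open>- x\<close> by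
    \<open>turn\<close>.\<close>
  have "((- x) \<star> y) \<bullet> z = 0" by (rule zero[OF turn[OF Q(1)] Q(2,3)])
  then show ?thesis by (simp add: mul_simps)
qed

end

section \<open>The axis in \<open>V2\<close> and the isometries built from it\<close>

lemma ex_orthonormal_triple:
  fixes V :: "'a::euclidean_space set"
  assumes "subspace V" "dim V = 3"
  obtains a b c where "a \<in> V" "b \<in> V" "c \<in> V" "a \<bullet> a = 1" "b \<bullet> b = 1" "c \<bullet> c = 1"
    "a \<bullet> b = 0" "a \<bullet> c = 0" "b \<bullet> c = 0"
proof -
  obtain B where B: "B \<subseteq> V" "pairwise orthogonal B" "\<And>x. x \<in> B \<Longrightarrow> norm x = 1" "card B = dim V"
    using orthonormal_basis_subspace[OF assms(1)] by metis
  then obtain a b c where abc: "B = {a, b, c}" "a \<noteq> b" "b \<noteq> c" "a \<noteq> c"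
    using assms(2) card_3_iff[of B] by auto
  show thesis
    using B abc by (intro that[of a b c]) (auto simp: pairwise_def orthogonal_def norm_eq_1)
qed

context peirce_type_3_8
begin

text \<open>On the subspace from \<open>ex_large_subspace\<close> the form vanishes by
  \<open>null_triple\<close>, and its codimension in the eight-dimensional \<open>V2\<close> is at
  most 2, as \<open>rigid_eiconal_product\<close> requires.\<close>

lemma ex_axis:
  obtains \<theta> where "\<theta> \<in> V2" "\<theta> \<bullet> \<theta> = 1 / 2" "p2 (\<theta> \<star> \<theta>) = - (1 / 2) *\<^sub>R \<theta>"
    "\<And>b. b \<in> V2 \<Longrightarrow> b \<bullet> \<theta> = 0 \<Longrightarrow> p2 (\<theta> \<star> b) = (1 / 2) *\<^sub>R b"
proof -
  obtain a1 a2 a3 where a: "a1 \<in> V1" "a2 \<in> V1" "a1 \<bullet> a1 = 1" "a2 \<bullet> a2 = 1" "a1 \<bullet> a2 = 0"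
    using ex_orthonormal_triple[OF subspaces(1) dim_V1] by metis
  obtain K where K: "subspace K" "K \<subseteq> V2" "6 \<le> dim K" "\<And>x. x \<in> K \<Longrightarrow> \<exists>y\<in>V2. a2 \<star> x = a1 \<star> y"
    using ex_large_subspace[OF a(1,3,2)] by blast
  have "\<exists>\<theta>\<in>V2. \<theta> \<bullet> \<theta> = 1 / 2 \<and> p2 (\<theta> \<star> \<theta>) = - (1 / 2) *\<^sub>R \<theta> \<and>
    (\<forall>b\<in>V2. b \<bullet> \<theta> = 0 \<longrightarrow> p2 (\<theta> \<star> b) = (1 / 2) *\<^sub>R b)"
  proof (rule rigid_eiconal_product[OF _ _ subspaces(2) _ _ _ K(1-3)])
    show "bilinear (\<lambda>a b. p2 (a \<star> b))"
      using lin(2) by (auto simp: bilinear_def mul_simps linear_add linear_scale intro!: linearI)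
    show "p2 (a \<star> b) = p2 (b \<star> a)" for a b by (simp only: comm)
    show "p2 (a \<star> b) \<in> V2" for a b by (rule range)
    show "p2 (a \<star> b) \<bullet> c = a \<bullet> p2 (b \<star> c)" if "a \<in> V2" "b \<in> V2" "c \<in> V2" for a b c
      using proj(2)[OF that(3), of "a \<star> b"] proj(2)[OF that(1), of "b \<star> c"] assoc[of a b c]
      by (simp add: inner_commute)
    show "p2 (a \<star> a) \<bullet> p2 (a \<star> a) = (a \<bullet> a)\<^sup>2 / 2" if "a \<in> V2" for a
      by (rule norm_V2_square[OF that])
    show "dim V2 \<le> dim K + 2" using K(3) dim_V2 by simp
    show "p2 (x \<star> y) \<bullet> z = 0" if "x \<in> K" "y \<in> K" "z \<in> K" for x y z
    proof -
      obtain x' where x': "x' \<in> V2" "a2 \<star> x = a1 \<star> x'" using K(4)[OF \<open>x \<in> K\<close>] by blast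
      obtain y' where y': "y' \<in> V2" "a2 \<star> y = a1 \<star> y'" using K(4)[OF \<open>y \<in> K\<close>] by blast
      obtain z' where z': "z' \<in> V2" "a2 \<star> z = a1 \<star> z'" using K(4)[OF \<open>z \<in> K\<close>] by blast
      have xyz: "x \<in> V2" "y \<in> V2" "z \<in> V2" using that K(2) by auto
      have "(x \<star> y) \<bullet> z = 0"
        by (rule null_triple[OF a(1,3,2,4,5) xyz(1) x' xyz(2) y' xyz(3) z'])
      then show ?thesis using proj(2)[OF xyz(3), of "x \<star> y"] by simp
    qed
  qed
  then show thesis using that by blast
qed

context
  fixes \<theta>
  assumes \<theta>: "\<theta> \<in> V2" "\<theta> \<bullet> \<theta> = 1 / 2" "p2 (\<theta> \<star> \<theta>) = - (1 / 2) *\<^sub>R \<theta>"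
    and \<theta>_orth: "\<And>b. b \<in> V2 \<Longrightarrow> b \<bullet> \<theta> = 0 \<Longrightarrow> p2 (\<theta> \<star> b) = (1 / 2) *\<^sub>R b"
begin

text \<open>The value is the inner product of \<theta> with the \<open>V2\<close> component of
  \<open>c \<star> c\<close>. By \<open>norm_V3_square\<close> that component has squared length at
  most \<open>(c \<bullet> c)\<^sup>2 / 2\<close>, so Cauchy-Schwarz with
  \<open>\<theta> \<bullet> \<theta> = 1 / 2\<close> gives the bound.\<close>

lemma axis_lower_bound:
  assumes c: "c \<in> V3"
  shows "- (c \<bullet> c) / 2 \<le> (\<theta> \<star> c) \<bullet> c"
proof -
  define S where "S = p2 (c \<star> c)"
  have "S \<bullet> S \<le> (c \<bullet> c)\<^sup>2 / 2"
    using norm_V3_square[OF c] inner_ge_zero[of "p1 (c \<star> c)"] unfolding S_def by linarith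
  then have "(S \<bullet> \<theta>)\<^sup>2 \<le> ((c \<bullet> c) / 2)\<^sup>2"
    using Cauchy_Schwarz_ineq[of S \<theta>] \<theta>(2) by (simp add: power2_eq_square)
  then have "\<bar>S \<bullet> \<theta>\<bar> \<le> \<bar>(c \<bullet> c) / 2\<bar>" by (rule abs_le_square_iff[THEN iffD2])
  moreover have "(\<theta> \<star> c) \<bullet> c = S \<bullet> \<theta>"
    using proj(2)[OF \<theta>(1), of "c \<star> c"] inner_mul_rotate[of \<theta> c c] by (simp add: S_def)
  ultimately show ?thesis by simp
qed

text \<open>By the lower bound, the vectors \<open>a' \<star> b\<close> are eigenvectors of the compression of \<open>\<theta> \<star>\<close> to
  \<open>V3\<close> for its least eigenvalue \<open>-1/2\<close>, while \<open>a \<star> \<theta>\<close> is one for \<open>1/2\<close>.\<close>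
lemma axis_orth:
  assumes a: "a \<in> V1" and a': "a' \<in> V1" and b: "b \<in> V2" "b \<bullet> \<theta> = 0"
  shows "(a \<star> \<theta>) \<bullet> (a' \<star> b) = 0"
proof -
  define z where "z = a' \<star> b"
  define w where "w = a \<star> \<theta>"
  have V3: "z \<in> V3" "w \<in> V3" using mul_12_mem a a' b(1) \<theta>(1) by (auto simp: z_def w_def)
  have zz: "(\<theta> \<star> z) \<bullet> z = - (z \<bullet> z) / 2"
    using V2_on_V1_V2[OF a' \<theta>(1) b(1) b(1)] proj(2)[OF b(1), of "\<theta> \<star> b"] \<theta>_orth[OF b]
      norm_V1_V2[OF a' b(1)] by (simp add: z_def)
  have wz: "(\<theta> \<star> w) \<bullet> z = (w \<bullet> z) / 2"
    using V2_square_V1_V3[OF a \<theta>(1) V3(1)] \<theta>(3) inner_mul_commute[of \<theta> w z]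
      inner_mul_commute[of a z \<theta>] by (simp add: w_def inner_commute)
  have "0 \<le> 2 * t * (w \<bullet> z) + t\<^sup>2 * ((\<theta> \<star> w) \<bullet> w + (w \<bullet> w) / 2)" for t
    using axis_lower_bound[OF subspace_add[OF subspaces(3) V3(1) subspace_scale[OF subspaces(3) V3(2)]], of t]
      zz wz inner_mul_commute[of \<theta> z w]
    by (simp add: mul_simps inner_add_left inner_add_right inner_commute[of z w] power2_eq_square
        field_simps)
  then have "w \<bullet> z = 0" by (rule nonneg_quadratic_linear_coeff)
  then show ?thesis by (simp add: w_def z_def)
qed

lemma axis_isometry: "a \<in> V1 \<Longrightarrow> u \<in> V1 \<Longrightarrow> (a \<star> \<theta>) \<bullet> (u \<star> \<theta>) = (a \<bullet> u) / 8"
  using inner_V1_V2_V1_V2'[of a u \<theta> \<theta>] \<theta>(1,2) by (simp add: inner_commute[of "u \<star> \<theta>"])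

lemma axis_p2:
  assumes a: "a \<in> V1" and u: "u \<in> V1"
  shows "p2 (a \<star> (u \<star> \<theta>)) = ((a \<bullet> u) / 4) *\<^sub>R \<theta>"
proof -
  let ?d = "p2 (a \<star> (u \<star> \<theta>)) - ((a \<bullet> u) / 4) *\<^sub>R \<theta>"
  have "?d \<bullet> v = 0" if v: "v \<in> V2" for v
  proof -
    \<comment> \<open>The part of \<open>v\<close> orthogonal to the axis; the factor 2 is the
      inverse of \<open>\<theta> \<bullet> \<theta>\<close>.\<close>
    define v' where "v' = v - (2 * (v \<bullet> \<theta>)) *\<^sub>R \<theta>"
    have v': "v' \<in> V2" "v' \<bullet> \<theta> = 0"
      using v \<theta>(1,2) subspaces(2)
      by (simp_all add: v'_def subspace_diff subspace_scale inner_diff_left)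
    have "v = v' + (2 * (v \<bullet> \<theta>)) *\<^sub>R \<theta>" by (simp add: v'_def)
    then have "(a \<star> v) \<bullet> (u \<star> \<theta>) = (a \<star> v') \<bullet> (u \<star> \<theta>) + 2 * (v \<bullet> \<theta>) * ((a \<star> \<theta>) \<bullet> (u \<star> \<theta>))"
      by (metis bilinear_radd[OF bil] bilinear_rmul[OF bil] inner_add_left inner_scaleR_left)
    also have "\<dots> = (a \<bullet> u) / 4 * (\<theta> \<bullet> v)"
      using axis_orth[OF u a v'] axis_isometry[OF a u] by (simp add: inner_commute)
    finally show ?thesis
      using proj(2)[OF v, of "a \<star> (u \<star> \<theta>)"] inner_mul_commute[of a v "u \<star> \<theta>"]
      by (simp add: inner_diff_left)
  qed
  moreover have "?d \<in> V2" using \<theta>(1) by (intro subspace_diff subspace_scale subspaces range)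
  ultimately have "?d \<bullet> ?d = 0" by blast
  then show ?thesis by simp
qed

text \<open>The trilinear form is symmetric in its last two arguments and, by
  \<open>V1_V2_orth_V1_V3'\<close>, skew under exchange of the first and the last. Such a form is
  zero.\<close>

lemma axis_skew:
  assumes "a \<in> V1" "u \<in> V1" "u' \<in> V1"
  shows "(a \<star> (u \<star> \<theta>)) \<bullet> (u' \<star> \<theta>) = 0"
proof -
  define g where "g a u u' = (a \<star> (u \<star> \<theta>)) \<bullet> (u' \<star> \<theta>)" for a u u'
  have sym: "g x y z = g x z y" for x y z unfolding g_def by (rule inner_mul_commute)
  have skew: "g y z x + g x z y = 0" if "x \<in> V1" "y \<in> V1" "z \<in> V1" for x y z
    using V1_V2_orth_V1_V3'[OF that(1,2) \<theta>(1) mul_12_mem[OF that(3) \<theta>(1)]]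
    by (simp add: g_def inner_commute)
  show ?thesis
    using skew[of a u u'] skew[of a u' u] skew[of u u' a] sym[of a u u'] sym[of u a u'] sym[of u' a u]
      assms by (simp add: g_def)
qed

text \<open>The coefficients are chosen to make this a similarity of ratio \<open>norm a\<close> on
  the sum of \<open>V1\<close> and the complement of \<theta> in \<open>V2\<close>. The part in
  \<open>V3\<close> coming from \<open>u\<close> in \<open>V1\<close> falls short of the required
  length by \<open>(a \<bullet> u)\<^sup>2\<close>, which the component along \<open>e\<close>
  supplies.\<close>

definition axis_map :: "'a \<Rightarrow> 'a \<Rightarrow> 'a" where
  "axis_map a x = sqrt (32 / 3) *\<^sub>R p3 (a \<star> (p1 x \<star> \<theta>)) + 2 *\<^sub>R (a \<star> p2 x) + (a \<bullet> p1 x) *\<^sub>R e"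

lemma linear_axis_map: "linear (axis_map a)"
  using lin by (intro linearI)
    (simp_all add: axis_map_def linear_add linear_scale mul_simps inner_add_right algebra_simps)

lemma axis_map_add: "axis_map (a + b) x = axis_map a x + axis_map b x"
  using lin(3) by (simp add: axis_map_def mul_simps linear_add inner_add_left algebra_simps)

lemma norm_axis_map:
  assumes a: "a \<in> V1" and u: "u \<in> V1" and v: "v \<in> V2" "v \<bullet> \<theta> = 0"
  shows "axis_map a (u + v) \<bullet> axis_map a (u + v) = (a \<bullet> a) * ((u + v) \<bullet> (u + v))"
proof -
  define C where "C = p3 (a \<star> (u \<star> \<theta>))"
  define D where "D = a \<star> v"
  have w: "u \<star> \<theta> \<in> V3" by (rule mul_12_mem[OF u \<theta>(1)])
  have p: "p1 (u + v) = u" "p2 (u + v) = v"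
    using lin u v(1) proj_fix(1)[OF u] proj_fix(2)[OF v(1)] proj_zero(1)[of v] proj_zero(2)[of u]
    by (simp_all add: linear_add orth orth_sym)
  have D: "D \<in> V3" "D \<bullet> D = (a \<bullet> a) * (v \<bullet> v) / 4"
    using mul_12_mem[OF a v(1)] norm_V1_V2[OF a v(1)] by (simp_all add: D_def)
  have CD: "C \<bullet> D = 0"
    using V1_V2_orth_V1_V3[OF a v(1) w] proj(3)[OF D(1), of "a \<star> (u \<star> \<theta>)"]
    by (simp add: C_def D_def inner_commute)
  \<comment> \<open>By \<open>norm_V1_V3\<close>, where \<open>u \<star> \<theta>\<close> has
    squared length \<open>(u \<bullet> u) / 8\<close> and the \<open>V2\<close> component is known
    from \<open>axis_p2\<close>. The factor 3/32 is what \<open>sqrt (32 / 3)\<close> in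
    \<open>axis_map\<close> compensates.\<close>
  have CC: "C \<bullet> C = 3 / 32 * ((a \<bullet> a) * (u \<bullet> u) - (a \<bullet> u)\<^sup>2)"
    using norm_V1_V3[OF a w] axis_p2[OF a u] axis_isometry[OF u u] \<theta>(2)
    by (simp add: C_def power2_eq_square field_simps)
  define k :: real where "k = sqrt (32 / 3)"
  have k: "k * k = 32 / 3" by (simp add: k_def)
  have "axis_map a (u + v) = k *\<^sub>R C + 2 *\<^sub>R D + (a \<bullet> u) *\<^sub>R e"
    by (simp add: axis_map_def p C_def D_def k_def)
  moreover have "C \<bullet> e = 0" "D \<bullet> e = 0" "e \<bullet> C = 0" "e \<bullet> D = 0" "D \<bullet> C = 0"
    using D(1) range(3) CD by (simp_all add: C_def orth_e orth_e_sym inner_commute[of D])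
  ultimately have "axis_map a (u + v) \<bullet> axis_map a (u + v) = k * k * (C \<bullet> C) + 4 * (D \<bullet> D) + (a \<bullet> u)\<^sup>2"
    using CD ee by (simp add: inner_add_left inner_add_right power2_eq_square)
  also have "\<dots> = (a \<bullet> a) * (u \<bullet> u + v \<bullet> v)"
    by (simp add: k CC D(2) field_simps)
  also have "u \<bullet> u + v \<bullet> v = (u + v) \<bullet> (u + v)"
    using u v by (simp add: inner_add_left inner_add_right orth orth_sym)
  finally show ?thesis .
qed

text \<open>The source \<open>U\<close> has dimension 3 + 7. The target \<open>W\<close> is spanned
  by \<open>e\<close> and the complement \<open>M\<close> of the products of \<open>V1\<close> with
  \<theta> in \<open>V3\<close>, so it has dimension 1 + 9. An orthonormal basis of
  \<open>V1\<close> gives three mutually orthogonal isometries between them, but 4 does not divide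
  10.\<close>

lemma axis_contradiction: False
proof -
  define T where "T = {v \<in> V2. \<forall>x\<in>span {\<theta>}. orthogonal x v}"
  have T: "T = {v \<in> V2. v \<bullet> \<theta> = 0}"
    unfolding T_def orthogonal_span_iff by (simp add: inner_commute)
  have "\<theta> \<noteq> 0" using \<theta>(2) by auto
  have sT: "subspace T" using subspaces(2) by (auto simp: T subspace_def inner_add_left)
  have dT: "dim T = 7"
    using dim_subspace_orthogonal_to_vectors[of "span {\<theta>}" V2] \<theta>(1) subspaces(2) dim_V2 \<open>\<theta> \<noteq> 0\<close>
    by (simp add: T_def span_minimal dim_insert)
  define U where "U = {x + y |x y. x \<in> V1 \<and> y \<in> T}"
  have sU: "subspace U" unfolding U_def by (rule subspace_sums[OF subspaces(1) sT])
  have dU: "dim U = 10"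
    using dim_sums_orthogonal[OF subspaces(1) sT] orth(1) dim_V1 dT by (simp add: U_def T)
  let ?M = "(\<lambda>u. u \<star> \<theta>) ` V1"
  define M where "M = {z \<in> V3. \<forall>y\<in>?M. orthogonal y z}"
  have lM: "linear (\<lambda>u. u \<star> \<theta>)" by (rule linearI) (simp_all add: mul_simps)
  have "inj_on (\<lambda>u. u \<star> \<theta>) V1"
  proof (rule inj_onI)
    fix x y assume xy: "x \<in> V1" "y \<in> V1" "x \<star> \<theta> = y \<star> \<theta>"
    then have "x - y \<in> V1" "(x - y) \<star> \<theta> = 0"
      using subspaces(1) by (simp_all add: mul_simps subspace_diff)
    then show "x = y" using axis_isometry[of "x - y" "x - y"] by simp
  qed
  then have "dim ?M = 3"
    using dim_image_eq[of "\<lambda>u. u \<star> \<theta>" V1] lM dim_V1 subspaces(1)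
    by (simp add: span_eq_iff[THEN iffD2])
  moreover have "dim M + dim ?M = dim V3"
    unfolding M_def using linear_subspace_image[OF lM subspaces(1)] subspaces(3) mul_12_mem[OF _ \<theta>(1)]
    by (intro dim_subspace_orthogonal_to_vectors) auto
  ultimately have dM: "dim M = 9" using dim_V3 by simp
  have sM: "subspace M" using subspaces(3)
    by (auto simp: M_def subspace_def orthogonal_def inner_add_right)
  define W where "W = {x + y |x y. x \<in> M \<and> y \<in> span {e}}"
  have sW: "subspace W" unfolding W_def by (rule subspace_sums[OF sM subspace_span])
  have "e \<noteq> 0" using ee by auto
  have "dim W = dim M + dim (span {e})"
    unfolding W_def
  proof (rule dim_sums_orthogonal[OF sM subspace_span])
    show "x \<bullet> y = 0" if "x \<in> M" "y \<in> span {e}" for x y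
      using that orth_e_sym(3) by (auto simp: M_def span_singleton)
  qed
  then have dW: "dim W = 10" using dM \<open>e \<noteq> 0\<close> by (simp add: dim_insert)
  have norm: "axis_map a x \<bullet> axis_map a x = (a \<bullet> a) * (x \<bullet> x)" if "a \<in> V1" "x \<in> U" for a x
    using that norm_axis_map by (auto simp: U_def T)
  have inner: "axis_map a x \<bullet> axis_map b x = (a \<bullet> b) * (x \<bullet> x)" if "a \<in> V1" "b \<in> V1" "x \<in> U" for a b x
    using norm[OF subspace_add[OF subspaces(1) that(1,2)] that(3)] norm[OF that(1,3)] norm[OF that(2,3)]
    by (simp add: axis_map_add inner_add_left inner_add_right inner_commute[of b a]
        inner_commute[of "axis_map b x" "axis_map a x"] algebra_simps)
  have im: "axis_map a x \<in> W" if a: "a \<in> V1" and x: "x \<in> U" for a x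
  proof -
    obtain u v where uv: "x = u + v" "u \<in> V1" "v \<in> V2" "v \<bullet> \<theta> = 0"
      using x by (auto simp: U_def T)
    have p: "p1 x = u" "p2 x = v"
      using lin uv proj_fix(1)[OF uv(2)] proj_fix(2)[OF uv(3)] proj_zero(1)[of v] proj_zero(2)[of u]
      by (simp_all add: linear_add orth orth_sym)
    \<comment> \<open>That the images avoid the products of \<open>V1\<close> with \<theta> is
      \<open>axis_skew\<close> for the \<open>V1\<close> part and \<open>axis_orth\<close> for the
      \<open>V2\<close> part.\<close>
    have "p3 (a \<star> (u \<star> \<theta>)) \<in> M"
      using axis_skew[OF a uv(2)] proj(3)[OF mul_12_mem[OF _ \<theta>(1)], of _ "a \<star> (u \<star> \<theta>)"] range(3)
      by (auto simp: M_def orthogonal_def inner_commute)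
    moreover have "a \<star> v \<in> M"
      using axis_orth[OF _ a uv(3,4)] mul_12_mem[OF a uv(3)] by (auto simp: M_def orthogonal_def)
    ultimately have "sqrt (32 / 3) *\<^sub>R p3 (a \<star> (u \<star> \<theta>)) + 2 *\<^sub>R (a \<star> v) \<in> M"
      using sM by (simp add: subspace_add subspace_scale)
    moreover have "(a \<bullet> u) *\<^sub>R e \<in> span {e}" by (simp add: span_base span_scale)
    ultimately show ?thesis unfolding W_def axis_map_def p by blast
  qed
  obtain a b c where abc: "a \<in> V1" "b \<in> V1" "c \<in> V1" "a \<bullet> a = 1" "b \<bullet> b = 1" "c \<bullet> c = 1"
    "a \<bullet> b = 0" "a \<bullet> c = 0" "b \<bullet> c = 0"
    using ex_orthonormal_triple[OF subspaces(1) dim_V1] by metis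
  have "4 dvd dim U"
    by (rule dim_three_orthogonal_isometries[OF sU sW _ linear_axis_map[of a] linear_axis_map[of b] linear_axis_map[of c]])
      (simp_all add: im abc norm inner norm_eq dU dW)
  then show False using dU by simp
qed

end

theorem no_type_3_8: False
  using ex_axis axis_contradiction by metis

end

section \<open>Cubic forms and their normal forms\<close>

definition trilinear :: "('a::real_vector \<Rightarrow> 'a \<Rightarrow> 'a \<Rightarrow> real) \<Rightarrow> bool" where
  "trilinear T \<longleftrightarrow> (\<forall>y z. linear (\<lambda>x. T x y z)) \<and> (\<forall>x z. linear (\<lambda>y. T x y z)) \<and>
    (\<forall>x y. linear (\<lambda>z. T x y z))"

lemma trilinear_add: "trilinear S \<Longrightarrow> trilinear T \<Longrightarrow> trilinear (\<lambda>x y z. S x y z + T x y z)"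
  by (simp add: trilinear_def linear_compose_add)

lemma linear_real_mult:
  fixes f :: "'a::real_vector \<Rightarrow> real"
  assumes "linear f"
  shows "linear (\<lambda>x. c * f x)" "linear (\<lambda>x. f x * c)"
  by (rule linearI; simp add: linear_add[OF assms] linear_scale[OF assms] algebra_simps)+

lemma trilinear_scale: "trilinear T \<Longrightarrow> trilinear (\<lambda>x y z. c * T x y z)"
  by (simp add: trilinear_def linear_real_mult)

lemma trilinear_zero: "trilinear (\<lambda>x y z. 0)"
  by (simp add: trilinear_def linear_zero)

lemma trilinear_perm:
  "trilinear T \<Longrightarrow> trilinear (\<lambda>x y z. T x z y)" "trilinear T \<Longrightarrow> trilinear (\<lambda>x y z. T y x z)"
  "trilinear T \<Longrightarrow> trilinear (\<lambda>x y z. T y z x)" "trilinear T \<Longrightarrow> trilinear (\<lambda>x y z. T z x y)"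
  "trilinear T \<Longrightarrow> trilinear (\<lambda>x y z. T z y x)"
  by (simp_all add: trilinear_def)

lemma trilinear_mult:
  assumes "linear l" "bilinear B"
  shows "trilinear (\<lambda>x y z. l x * B y z)" "trilinear (\<lambda>x y z. B x y * l z)"
  using assms by (simp_all add: trilinear_def bilinear_def linear_real_mult)

text \<open>Only the coefficients up to degree 3 on each ray are tracked, so that no general notion of
  polynomial degree is needed.\<close>
lemma real_polynomial_function_cubic_part:
  fixes f :: "'a::real_normed_vector \<Rightarrow> real"
  assumes "real_polynomial_function f"
  shows "\<exists>c l B T. linear l \<and> bilinear B \<and> trilinear T \<and>
    (\<forall>x. \<exists>p. (\<forall>t. f (t *\<^sub>R x) = poly p t) \<and> coeff p 0 = c \<and> coeff p 1 = l x \<and>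
      coeff p 2 = B x x \<and> coeff p 3 = T x x x)"
  using assms
proof (induction rule: real_polynomial_function.induct)
  case (linear f)
  have l: "linear f" using linear by (rule bounded_linear.linear)
  have "\<forall>x. \<exists>p. (\<forall>t. f (t *\<^sub>R x) = poly p t) \<and> coeff p 0 = 0 \<and> coeff p 1 = f x \<and>
      coeff p 2 = (\<lambda>x y. 0) x x \<and> coeff p 3 = (\<lambda>x y z. 0) x x x"
  proof
    fix x
    show "\<exists>p. (\<forall>t. f (t *\<^sub>R x) = poly p t) \<and> coeff p 0 = 0 \<and> coeff p 1 = f x \<and>
      coeff p 2 = (\<lambda>x y. 0) x x \<and> coeff p 3 = (\<lambda>x y z. 0) x x x"
      by (rule exI[of _ "[:0, f x:]"]) (simp add: linear_scale[OF l] numeral_2_eq_2 numeral_3_eq_3)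
  qed
  moreover have "bilinear (\<lambda>x y::'a. 0::real)" by (simp add: bilinear_def linear_zero)
  ultimately show ?case using l trilinear_zero by blast
next
  case (const c)
  have "\<forall>x::'a. \<exists>p. (\<forall>t. c = poly p t) \<and> coeff p 0 = c \<and> coeff p 1 = (\<lambda>x. 0) x \<and>
      coeff p 2 = (\<lambda>x y. 0) x x \<and> coeff p 3 = (\<lambda>x y z. 0) x x x"
    by (rule allI, rule exI[of _ "[:c:]"]) (simp add: numeral_2_eq_2 numeral_3_eq_3)
  moreover have "bilinear (\<lambda>x y::'a. 0::real)" by (simp add: bilinear_def linear_zero)
  ultimately show ?case using linear_zero trilinear_zero by blast
next
  case (add f g)
  then obtain c l B T c' l' B' T' where
    f: "linear l" "bilinear B" "trilinear T"
      "\<And>x. \<exists>p. (\<forall>t. f (t *\<^sub>R x) = poly p t) \<and> coeff p 0 = c \<and> coeff p 1 = l x \<and>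
        coeff p 2 = B x x \<and> coeff p 3 = T x x x" and
    g: "linear l'" "bilinear B'" "trilinear T'"
      "\<And>x. \<exists>p. (\<forall>t. g (t *\<^sub>R x) = poly p t) \<and> coeff p 0 = c' \<and> coeff p 1 = l' x \<and>
        coeff p 2 = B' x x \<and> coeff p 3 = T' x x x"
    by blast
  have "\<forall>x. \<exists>p. (\<forall>t. f (t *\<^sub>R x) + g (t *\<^sub>R x) = poly p t) \<and> coeff p 0 = c + c' \<and>
      coeff p 1 = (\<lambda>x. l x + l' x) x \<and> coeff p 2 = (\<lambda>x y. B x y + B' x y) x x \<and>
      coeff p 3 = (\<lambda>x y z. T x y z + T' x y z) x x x"
  proof
    fix x
    obtain p q where "(\<forall>t. f (t *\<^sub>R x) = poly p t) \<and> coeff p 0 = c \<and> coeff p 1 = l x \<and>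
        coeff p 2 = B x x \<and> coeff p 3 = T x x x"
      "(\<forall>t. g (t *\<^sub>R x) = poly q t) \<and> coeff q 0 = c' \<and> coeff q 1 = l' x \<and>
        coeff q 2 = B' x x \<and> coeff q 3 = T' x x x" using f(4)[of x] g(4)[of x] by blast
    then show "\<exists>p. (\<forall>t. f (t *\<^sub>R x) + g (t *\<^sub>R x) = poly p t) \<and> coeff p 0 = c + c' \<and>
      coeff p 1 = (\<lambda>x. l x + l' x) x \<and> coeff p 2 = (\<lambda>x y. B x y + B' x y) x x \<and>
      coeff p 3 = (\<lambda>x y z. T x y z + T' x y z) x x x"
      by (intro exI[of _ "p + q"]) simp
  qed
  moreover have "linear (\<lambda>x. l x + l' x)" "bilinear (\<lambda>x y. B x y + B' x y)"
    using f g by (simp_all add: linear_compose_add bilinear_def)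
  moreover have "trilinear (\<lambda>x y z. T x y z + T' x y z)" using f(3) g(3) by (rule trilinear_add)
  ultimately show ?case by blast
next
  case (mult f g)
  then obtain c l B T c' l' B' T' where
    f: "linear l" "bilinear B" "trilinear T"
      "\<And>x. \<exists>p. (\<forall>t. f (t *\<^sub>R x) = poly p t) \<and> coeff p 0 = c \<and> coeff p 1 = l x \<and>
        coeff p 2 = B x x \<and> coeff p 3 = T x x x" and
    g: "linear l'" "bilinear B'" "trilinear T'"
      "\<And>x. \<exists>p. (\<forall>t. g (t *\<^sub>R x) = poly p t) \<and> coeff p 0 = c' \<and> coeff p 1 = l' x \<and>
        coeff p 2 = B' x x \<and> coeff p 3 = T' x x x"
    by blast
  \<comment> \<open>These are the coefficients of the product of two polynomials along a ray, up to
    degree 3. The forms need not be symmetric, as only their diagonal values are compared.\<close>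
  define L where "L x = c * l' x + c' * l x" for x
  define BB where "BB x y = c * B' x y + (l x * l' y + c' * B x y)" for x y
  define TT where "TT x y z = c * T' x y z + (l x * B' y z + (B x y * l' z + c' * T x y z))" for x y z
  have "\<forall>x. \<exists>p. (\<forall>t. f (t *\<^sub>R x) * g (t *\<^sub>R x) = poly p t) \<and> coeff p 0 = c * c' \<and>
      coeff p 1 = L x \<and> coeff p 2 = BB x x \<and> coeff p 3 = TT x x x"
  proof
    fix x
    obtain p q where p: "(\<forall>t. f (t *\<^sub>R x) = poly p t) \<and> coeff p 0 = c \<and> coeff p 1 = l x \<and>
        coeff p 2 = B x x \<and> coeff p 3 = T x x x"
      and q: "(\<forall>t. g (t *\<^sub>R x) = poly q t) \<and> coeff q 0 = c' \<and> coeff q 1 = l' x \<and>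
        coeff q 2 = B' x x \<and> coeff q 3 = T' x x x" using f(4)[of x] g(4)[of x] by blast
    have "coeff (p * q) 0 = c * c'" "coeff (p * q) 1 = L x" "coeff (p * q) 2 = BB x x"
      "coeff (p * q) 3 = TT x x x"
      using p q by (simp_all add: coeff_mult L_def BB_def TT_def numeral_2_eq_2 numeral_3_eq_3)
    then show "\<exists>p. (\<forall>t. f (t *\<^sub>R x) * g (t *\<^sub>R x) = poly p t) \<and> coeff p 0 = c * c' \<and>
      coeff p 1 = L x \<and> coeff p 2 = BB x x \<and> coeff p 3 = TT x x x"
      using p q by (intro exI[of _ "p * q"]) simp
  qed
  moreover have "linear L"
    unfolding L_def using f(1) g(1) by (intro linear_compose_add linear_real_mult)
  moreover have "bilinear BB"
    using f(1,2) g(1,2) by (auto simp: BB_def bilinear_def intro!: linear_compose_add linear_real_mult)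
  moreover have "trilinear TT"
    unfolding TT_def using f g by (intro trilinear_add trilinear_scale trilinear_mult)
  ultimately show ?case by blast
qed

lemma cubic_form_product:
  fixes f :: "'a::euclidean_space \<Rightarrow> real"
  assumes f: "homogeneous_polynomial 3 f"
  obtains mul :: "'a \<Rightarrow> 'a \<Rightarrow> 'a" where "bilinear mul" "\<And>x y. mul x y = mul y x"
    "\<And>x y z. mul x y \<bullet> z = x \<bullet> mul y z" "\<And>x. f x = mul x x \<bullet> x"
proof -
  obtain c l B T where T: "trilinear T" and
    p: "\<And>x. \<exists>p. (\<forall>t. f (t *\<^sub>R x) = poly p t) \<and> coeff p 0 = c \<and> coeff p 1 = l x \<and>
      coeff p 2 = B x x \<and> coeff p 3 = T x x x"
    using real_polynomial_function_cubic_part[of f] f by (auto simp: homogeneous_polynomial_def)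
  \<comment> \<open>Homogeneity makes the restriction to the ray through \<open>x\<close> the
    monomial with coefficient \<open>f x\<close> in degree 3.\<close>
  have fT: "f x = T x x x" for x
  proof -
    obtain p where p: "\<And>t. f (t *\<^sub>R x) = poly p t" "coeff p 3 = T x x x" using p[of x] by blast
    have "poly p t = poly (monom (f x) 3) t" for t
      using p(1)[of t] f by (simp add: homogeneous_polynomial_def poly_monom mult.commute)
    then have "p = monom (f x) 3" by (simp add: poly_eq_poly_eq_iff[symmetric] fun_eq_iff)
    then show ?thesis using p(2) by simp
  qed
  \<comment> \<open>Averaging over the six permutations keeps the diagonal values and makes the form
    symmetric. The product \<open>mul\<close> represents it through the inner product.\<close>
  define S where "S x y z = (1 / 6) * (T x y z + (T x z y + (T y x z + (T y z x + (T z x y + T z y x)))))" for x y z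
  have S: "trilinear S"
    unfolding S_def using T trilinear_perm[OF T] by (intro trilinear_scale trilinear_add)
  have sym: "S x y z = S y x z" "S x y z = S y z x" for x y z
    by (simp_all add: S_def)
  define mul where "mul x y = (\<Sum>b\<in>Basis. S x y b *\<^sub>R b)" for x y
  have inner: "mul x y \<bullet> z = S x y z" for x y z
  proof -
    have "linear (\<lambda>z. S x y z)" using S by (simp add: trilinear_def)
    then have "S x y (\<Sum>b\<in>Basis. (z \<bullet> b) *\<^sub>R b) = (\<Sum>b\<in>Basis. (z \<bullet> b) * S x y b)"
      by (simp add: linear_sum linear_scale)
    then have "S x y z = (\<Sum>b\<in>Basis. (z \<bullet> b) * S x y b)" by (simp only: euclidean_representation)
    then show ?thesis
      unfolding mul_def inner_sum_left inner_scaleR_left by (simp add: inner_commute mult.commute)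
  qed
  show thesis
  proof (rule that[of mul])
    have l: "linear (\<lambda>x. S x y z)" "linear (\<lambda>x. S y x z)" for y z
      using S by (simp_all add: trilinear_def)
    show "bilinear mul"
      unfolding bilinear_def mul_def
      by (auto intro!: linearI simp: linear_add[OF l(1)] linear_add[OF l(2)] linear_scale[OF l(1)]
          linear_scale[OF l(2)] scaleR_left_distrib sum.distrib scaleR_right.sum)
    show "mul x y = mul y x" for x y using sym(1)[of x y] by (simp add: mul_def)
    show "mul x y \<bullet> z = x \<bullet> mul y z" for x y z
      using sym(2)[of x y z] inner[of x y z] inner[of y z x] by (simp add: inner_commute)
    show "f x = mul x x \<bullet> x" for x by (simp add: inner fT S_def)
  qed
qed

section \<open>The operator \<open>L_op\<close> on a cubic form\<close>

lemma partial_deriv_cubic: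
  fixes mul :: "real ^ 'n::finite \<Rightarrow> real ^ 'n \<Rightarrow> real ^ 'n"
  assumes bil: "bilinear mul" and comm: "\<And>x y. mul x y = mul y x"
    and assoc: "\<And>x y z. mul x y \<bullet> z = x \<bullet> mul y z" and f: "\<And>x. f x = mul x x \<bullet> x"
  shows "partial_deriv i f x = 3 * (mul x x \<bullet> axis i 1)"
    "partial_deriv j (partial_deriv i f) x = 6 * (mul x (axis j 1) \<bullet> axis i 1)"
proof -
  interpret bounded_bilinear mul
    using bil by (simp add: bilinear_conv_bounded_bilinear)
  have sq: "((\<lambda>x. mul x x) has_derivative (\<lambda>h. mul x h + mul h x)) (at x)" for x
    by (rule FDERIV[OF has_derivative_ident has_derivative_ident])
  have d1: "(f has_derivative (\<lambda>h. 3 * (mul x x \<bullet> h))) (at x)" for x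
  proof -
    have "(mul x h + mul h x) \<bullet> x = 2 * (mul x x \<bullet> h)" for h
    proof -
      have "mul h x \<bullet> x = mul x x \<bullet> h" using assoc[of h x x] by (simp add: inner_commute)
      then show ?thesis using comm[of x h] unfolding inner_add_left by simp
    qed
    then have "((\<lambda>x. mul x x \<bullet> x) has_derivative (\<lambda>h. 3 * (mul x x \<bullet> h))) (at x)"
      by (intro has_derivative_eq_rhs[OF has_derivative_inner[OF sq has_derivative_ident]]) auto
    then show ?thesis using f by presburger
  qed
  show p: "partial_deriv i f x = 3 * (mul x x \<bullet> axis i 1)" for i x
    unfolding partial_deriv_def by (simp add: frechet_derivative_at[OF d1, symmetric])
  have "((\<lambda>x. 3 * (mul x x \<bullet> axis i 1)) has_derivative (\<lambda>h. 6 * (mul x h \<bullet> axis i 1))) (at x)"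
  proof (rule has_derivative_eq_rhs[OF has_derivative_mult_right[OF has_derivative_inner_left[OF sq[of x]]]])
    show "(\<lambda>h. 3 * ((mul x h + mul h x) \<bullet> axis i 1)) = (\<lambda>h. 6 * (mul x h \<bullet> axis i 1))"
      unfolding inner_add_left by (simp add: comm[of _ x])
  qed
  then have "frechet_derivative (\<lambda>x. 3 * (mul x x \<bullet> axis i 1)) (at x) = (\<lambda>h. 6 * (mul x h \<bullet> axis i 1))"
    by (rule frechet_derivative_at[symmetric])
  then show "partial_deriv j (partial_deriv i f) x = 6 * (mul x (axis j 1) \<bullet> axis i 1)"
    unfolding partial_deriv_def[of j] p by simp
qed

lemma sum_Basis_vec: "(\<Sum>b\<in>Basis. g b) = (\<Sum>i\<in>UNIV. g (axis i (1::real)))"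
  for g :: "real ^ 'n::finite \<Rightarrow> real"
proof -
  have "(Basis :: (real ^ 'n) set) = range (\<lambda>i. axis i 1)"
    by (auto simp: Basis_vec_def)
  moreover have "inj (\<lambda>i::'n. axis i (1::real))" by (rule injI) (simp add: axis_eq_axis)
  ultimately show ?thesis using sum.reindex[of "\<lambda>i::'n. axis i (1::real)" UNIV g] by (simp add: o_def)
qed

text \<open>Both terms of the operator contain two first derivatives and one second derivative,
  hence the common factor 3 * 3 * 6 = 54.\<close>

lemma L_op_cubic:
  fixes mul :: "real ^ 'n::finite \<Rightarrow> real ^ 'n \<Rightarrow> real ^ 'n"
  assumes bil: "bilinear mul" and comm: "\<And>x y. mul x y = mul y x"
    and assoc: "\<And>x y z. mul x y \<bullet> z = x \<bullet> mul y z" and f: "\<And>x. f x = mul x x \<bullet> x"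
  shows "L_op f x = 54 * ((mul x x \<bullet> mul x x) * (\<Sum>b\<in>Basis. mul x b \<bullet> b)
    - mul x (mul x x) \<bullet> mul x x)"
proof -
  define w where "w = mul x x"
  note pd = partial_deriv_cubic[OF bil comm assoc f]
  have w: "w \<bullet> w = (\<Sum>i\<in>UNIV. (w \<bullet> axis i 1)\<^sup>2)"
    by (simp add: euclidean_inner[of w w] sum_Basis_vec power2_eq_square)
  have l: "linear (\<lambda>y. mul x y)" using bil by (simp add: bilinear_def)
  have "mul x w \<bullet> w = (\<Sum>a\<in>Basis. (mul x w \<bullet> a) * (w \<bullet> a))"
    by (rule euclidean_inner)
  \<comment> \<open>Expanding the inner \<open>w\<close> in coordinates as well produces the double
    sum of the second term of \<open>L_op\<close>.\<close>
  also have "\<dots> = (\<Sum>a\<in>Basis. (mul x (\<Sum>b\<in>Basis. (w \<bullet> b) *\<^sub>R b) \<bullet> a) * (w \<bullet> a))"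
    by (simp only: euclidean_representation)
  also have "\<dots> = (\<Sum>a\<in>Basis. \<Sum>b\<in>Basis. (w \<bullet> a) * (w \<bullet> b) * (mul x b \<bullet> a))"
    by (simp add: linear_sum[OF l] linear_scale[OF l] inner_sum_left sum_distrib_left sum_distrib_right
        mult_ac)
  finally have h: "mul x w \<bullet> w = (\<Sum>i\<in>UNIV. \<Sum>j\<in>UNIV. (w \<bullet> axis i 1) * (w \<bullet> axis j 1)
      * (mul x (axis j 1) \<bullet> axis i 1))"
    by (simp add: sum_Basis_vec)
  have "L_op f x = (\<Sum>i\<in>UNIV. 9 * (w \<bullet> axis i 1)\<^sup>2) * (\<Sum>i\<in>UNIV. 6 * (mul x (axis i 1) \<bullet> axis i 1))
     - (\<Sum>i\<in>UNIV. \<Sum>j\<in>UNIV. 54 * ((w \<bullet> axis i 1) * (w \<bullet> axis j 1) * (mul x (axis j 1) \<bullet> axis i 1)))"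
    unfolding L_op_def pd w_def[symmetric] by (simp add: power_mult_distrib mult_ac)
  also have "\<dots> = 54 * ((w \<bullet> w) * (\<Sum>b\<in>Basis. mul x b \<bullet> b) - mul x w \<bullet> w)"
    unfolding sum_distrib_left[symmetric] w[symmetric] h[symmetric]
    by (simp add: sum_Basis_vec)
  finally show ?thesis by (simp only: w_def)
qed

section \<open>From a normal form to a Peirce decomposition\<close>

text \<open>The scalars \<open>r\<close>, \<open>s\<close>, \<open>q\<close> make the degrees in the
  three variables explicit, so that particular numerical values can later separate the
  components.\<close>

lemma normal_form_expand:
  assumes "normal_form f e V1 V2 V3"
  obtains c g111 g102 g012 g030 where "c \<noteq> 0"
    "\<And>t r s q x y z. x \<in> V1 \<Longrightarrow> y \<in> V2 \<Longrightarrow> z \<in> V3 \<Longrightarrow>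
      c * f (t *\<^sub>R e + r *\<^sub>R x + s *\<^sub>R y + q *\<^sub>R z)
      = t ^ 3 - 3 / 2 * t * (2 * r\<^sup>2 * (x \<bullet> x) + s\<^sup>2 * (y \<bullet> y) - q\<^sup>2 * (z \<bullet> z))
        + r * s * q * g111 x y z + r * q\<^sup>2 * g102 x y z + s * q\<^sup>2 * g012 x y z + s ^ 3 * g030 x y z"
proof -
  obtain c \<psi>111 \<psi>102 \<psi>012 \<psi>030 where c: "c \<noteq> 0"
    and \<psi>: "trihomogeneous V1 V2 V3 1 1 1 \<psi>111" "trihomogeneous V1 V2 V3 1 0 2 \<psi>102"
      "trihomogeneous V1 V2 V3 0 1 2 \<psi>012" "trihomogeneous V1 V2 V3 0 3 0 \<psi>030"
    and f: "\<And>t x y z. x \<in> V1 \<Longrightarrow> y \<in> V2 \<Longrightarrow> z \<in> V3 \<Longrightarrow>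
      c * f (t *\<^sub>R e + x + y + z) =
        t ^ 3 - 3 / 2 * t * (2 * (norm x)\<^sup>2 + (norm y)\<^sup>2 - (norm z)\<^sup>2)
        + \<psi>111 x y z + \<psi>102 x y z + \<psi>012 x y z + \<psi>030 x y z"
    using assms unfolding normal_form_def by metis
  have V: "subspace V1" "subspace V2" "subspace V3"
    using assms by (simp_all add: normal_form_def orthogonal_decomposition_def)
  show thesis
  proof (rule that[OF c])
    fix t r s q :: real and x y z
    assume m: "x \<in> V1" "y \<in> V2" "z \<in> V3"
    have "c * f (t *\<^sub>R e + r *\<^sub>R x + s *\<^sub>R y + q *\<^sub>R z)
      = t ^ 3 - 3 / 2 * t * (2 * (norm (r *\<^sub>R x))\<^sup>2 + (norm (s *\<^sub>R y))\<^sup>2 - (norm (q *\<^sub>R z))\<^sup>2)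
        + \<psi>111 (r *\<^sub>R x) (s *\<^sub>R y) (q *\<^sub>R z) + \<psi>102 (r *\<^sub>R x) (s *\<^sub>R y) (q *\<^sub>R z)
        + \<psi>012 (r *\<^sub>R x) (s *\<^sub>R y) (q *\<^sub>R z) + \<psi>030 (r *\<^sub>R x) (s *\<^sub>R y) (q *\<^sub>R z)"
      by (rule f; rule subspace_scale; fact)
    also have "\<psi>111 (r *\<^sub>R x) (s *\<^sub>R y) (q *\<^sub>R z) = r * s * q * \<psi>111 x y z"
      using \<psi>(1) m by (simp add: trihomogeneous_def)
    also have "\<psi>102 (r *\<^sub>R x) (s *\<^sub>R y) (q *\<^sub>R z) = r * q\<^sup>2 * \<psi>102 x y z"
      using \<psi>(2) m by (simp add: trihomogeneous_def)
    also have "\<psi>012 (r *\<^sub>R x) (s *\<^sub>R y) (q *\<^sub>R z) = s * q\<^sup>2 * \<psi>012 x y z"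
      using \<psi>(3) m by (simp add: trihomogeneous_def)
    also have "\<psi>030 (r *\<^sub>R x) (s *\<^sub>R y) (q *\<^sub>R z) = s ^ 3 * \<psi>030 x y z"
      using \<psi>(4) m by (simp add: trihomogeneous_def)
    finally show "c * f (t *\<^sub>R e + r *\<^sub>R x + s *\<^sub>R y + q *\<^sub>R z)
      = t ^ 3 - 3 / 2 * t * (2 * r\<^sup>2 * (x \<bullet> x) + s\<^sup>2 * (y \<bullet> y) - q\<^sup>2 * (z \<bullet> z))
        + r * s * q * \<psi>111 x y z + r * q\<^sup>2 * \<psi>102 x y z + s * q\<^sup>2 * \<psi>012 x y z + s ^ 3 * \<psi>030 x y z"
      by (simp add: power_mult_distrib flip: power2_norm_eq_inner)
  qed
qed

lemma no_normal_form_3_8: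
  fixes f :: "real ^ 'n::finite \<Rightarrow> real"
  assumes rad: "radial_eigencubic f" and nf: "normal_form f e V1 V2 V3"
    and dims: "dim V1 = 3" "dim V2 = 8"
  shows False
proof -
  have hom: "homogeneous_polynomial 3 f" using rad by (simp add: radial_eigencubic_def)
  obtain l where l: "\<And>x. L_op f x = l * (norm x)\<^sup>2 * f x"
    using rad by (auto simp: radial_eigencubic_def)
  obtain m where m: "bilinear m" "\<And>x y. m x y = m y x" "\<And>x y z. m x y \<bullet> z = x \<bullet> m y z"
    "\<And>x. f x = m x x \<bullet> x"
    using cubic_form_product[OF hom] by blast
  obtain c g111 g102 g012 g030 where "c \<noteq> 0" and
    cf: "\<And>t r s q x y z. x \<in> V1 \<Longrightarrow> y \<in> V2 \<Longrightarrow> z \<in> V3 \<Longrightarrow>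
      c * f (t *\<^sub>R e + r *\<^sub>R x + s *\<^sub>R y + q *\<^sub>R z)
      = t ^ 3 - 3 / 2 * t * (2 * r\<^sup>2 * (x \<bullet> x) + s\<^sup>2 * (y \<bullet> y) - q\<^sup>2 * (z \<bullet> z))
        + r * s * q * g111 x y z + r * q\<^sup>2 * g102 x y z + s * q\<^sup>2 * g012 x y z + s ^ 3 * g030 x y z"
    using normal_form_expand[OF nf] by blast
  \<comment> \<open>The product belonging to \<open>c * f\<close>, which is the cubic that has the
    normal form exactly.\<close>
  define mul where "mul x y = c *\<^sub>R m x y" for x y
  have bil: "bilinear mul"
    using m(1) unfolding mul_def bilinear_def by (auto intro: linear_compose_scale_right)
  have comm: "mul x y = mul y x" for x y by (simp only: mul_def m(2))
  have assoc: "mul x y \<bullet> z = x \<bullet> mul y z" for x y z by (simp add: mul_def m(3))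
  have hs: "(mul x x \<bullet> mul x x) * (\<Sum>b\<in>Basis. mul x b \<bullet> b) - mul x (mul x x) \<bullet> mul x x
      = (c\<^sup>2 * l / 54) * (x \<bullet> x) * (mul x x \<bullet> x)" for x
  proof -
    have "(m x x \<bullet> m x x) * (\<Sum>b\<in>Basis. m x b \<bullet> b) - m x (m x x) \<bullet> m x x = l / 54 * (x \<bullet> x) * (m x x \<bullet> x)"
      using L_op_cubic[OF m(1-4), of x] l[of x] m(4)[of x] by (simp add: power2_norm_eq_inner)
    \<comment> \<open>The left side of the equation is cubic in the product. On the right one factor
      \<open>c\<close> is absorbed by the cubic form, which leaves the eigenvalue
      \<open>c\<^sup>2 * l / 54\<close>.\<close>
    then have "c ^ 3 * ((m x x \<bullet> m x x) * (\<Sum>b\<in>Basis. m x b \<bullet> b) - m x (m x x) \<bullet> m x x)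
      = c ^ 3 * (l / 54 * (x \<bullet> x) * (m x x \<bullet> x))" by (rule arg_cong)
    then show ?thesis
      by (simp add: mul_def bilinear_rmul[OF m(1)] power2_eq_square power3_eq_cube
          algebra_simps flip: sum_distrib_left)
  qed
  note bs = bilinear_ladd[OF bil] bilinear_radd[OF bil] bilinear_lneg[OF bil] bilinear_rneg[OF bil]
  have od: "orthogonal_decomposition e V1 V2 V3" using nf by (simp add: normal_form_def)
  have V: "subspace V1" "subspace V2" "subspace V3"
    using od by (simp_all add: orthogonal_decomposition_def)
  have z0: "0 \<in> V1" "0 \<in> V2" "0 \<in> V3" using V by (simp_all add: subspace_0)
  have ee: "e \<bullet> e = 1" using od by (simp add: orthogonal_decomposition_def norm_eq_1)
  have orth0: "e \<bullet> x = 0 \<and> e \<bullet> y = 0 \<and> e \<bullet> z = 0 \<and> x \<bullet> y = 0 \<and> x \<bullet> z = 0 \<and> y \<bullet> z = 0"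
    if "x \<in> V1" "y \<in> V2" "z \<in> V3" for x y z
    using od that by (simp add: orthogonal_decomposition_def orthogonal_def)
  have oe: "x \<in> V1 \<Longrightarrow> e \<bullet> x = 0" "y \<in> V2 \<Longrightarrow> e \<bullet> y = 0" "z \<in> V3 \<Longrightarrow> e \<bullet> z = 0" for x y z
    using orth0 z0 by blast+
  have o: "x \<in> V1 \<Longrightarrow> y \<in> V2 \<Longrightarrow> x \<bullet> y = 0" "x \<in> V1 \<Longrightarrow> z \<in> V3 \<Longrightarrow> x \<bullet> z = 0"
    "y \<in> V2 \<Longrightarrow> z \<in> V3 \<Longrightarrow> y \<bullet> z = 0" for x y z
    using orth0 z0 by blast+
  have os: "x \<in> V1 \<Longrightarrow> y \<in> V2 \<Longrightarrow> y \<bullet> x = 0" "x \<in> V1 \<Longrightarrow> z \<in> V3 \<Longrightarrow> z \<bullet> x = 0"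
    "y \<in> V2 \<Longrightarrow> z \<in> V3 \<Longrightarrow> z \<bullet> y = 0" "x \<in> V1 \<Longrightarrow> x \<bullet> e = 0" "y \<in> V2 \<Longrightarrow> y \<bullet> e = 0"
    "z \<in> V3 \<Longrightarrow> z \<bullet> e = 0" for x y z
    by (subst inner_commute, simp add: o oe)+
  have dec: "\<exists>t. \<exists>x\<in>V1. \<exists>y\<in>V2. \<exists>z\<in>V3. v = t *\<^sub>R e + x + y + z" for v
    using od by (simp add: orthogonal_decomposition_def)
  define F where "F v = mul v v \<bullet> v" for v
  have F: "F (t *\<^sub>R e + r *\<^sub>R x + s *\<^sub>R y + q *\<^sub>R z)
      = t ^ 3 - 3 / 2 * t * (2 * r\<^sup>2 * (x \<bullet> x) + s\<^sup>2 * (y \<bullet> y) - q\<^sup>2 * (z \<bullet> z))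
        + r * s * q * g111 x y z + r * q\<^sup>2 * g102 x y z + s * q\<^sup>2 * g012 x y z + s ^ 3 * g030 x y z"
    if "x \<in> V1" "y \<in> V2" "z \<in> V3" for t r s q x y z
    using cf[OF that] by (simp add: F_def mul_def m(4))
  have rot: "mul u v \<bullet> w = mul v w \<bullet> u" for u v w
    using assoc[of u v w] inner_commute[of u "mul v w"] by simp
  have F_add: "F (u + v) = F u + 3 * (mul u u \<bullet> v) + 3 * (mul v v \<bullet> u) + F v" for u v
    using rot[of u u v] rot[of v v u] comm[of v u]
    unfolding F_def bs inner_add_left inner_add_right by simp
  have F_neg: "F (- u) = - F u" for u by (simp add: F_def bs)
  have F1: "F x = 0" if x: "x \<in> V1" for x
    using F[OF x z0(2,3), of 0 1 0 0] by simp
  have F3: "F z = 0" if z: "z \<in> V3" for z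
    using F[OF z0(1,2) z, of 0 0 0 1] by simp
  \<comment> \<open>The values of \<open>F\<close> at \<open>x + y\<close> and
    \<open>- x + y\<close> both equal \<open>F y\<close>, since no term of the normal form involves
    only these two spaces jointly. Their sum and difference isolate the two mixed products. The next
    two facts use evenness in \<open>z\<close> instead.\<close>
  have n12: "mul x x \<bullet> y = 0" "mul y y \<bullet> x = 0" if "x \<in> V1" "y \<in> V2" for x y
    using F[OF that z0(3), of 0 1 1 0] F[OF that z0(3), of 0 "-1" 1 0] F[OF that z0(3), of 0 0 1 0]
      F1[OF that(1)] F_add[of x y] F_add[of "- x" y] F_neg[of x] by (simp_all add: bs)
  have n13: "mul x x \<bullet> z = 0" if "x \<in> V1" "z \<in> V3" for x z
    using F[OF that(1) z0(2) that(2), of 0 1 0 1] F[OF that(1) z0(2) that(2), of 0 1 0 "-1"]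
      F1[OF that(1)] F3[OF that(2)] F_add[of x z] F_add[of x "- z"] F_neg[of z] by (simp add: bs)
  have n23: "mul y y \<bullet> z = 0" if "y \<in> V2" "z \<in> V3" for y z
    using F[OF z0(1) that, of 0 0 1 1] F[OF z0(1) that, of 0 0 1 "-1"]
      F3[OF that(2)] F_add[of y z] F_add[of y "- z"] F_neg[of z] by (simp add: bs)
  have Fe: "mul e e \<bullet> e = 1" using F[OF z0, of 1 0 0 0] by (simp add: F_def)
  \<comment> \<open>The values of \<open>F\<close> at \<open>e + v\<close>, \<open>- e + v\<close>
    and \<open>v\<close> separate the parts linear and quadratic in \<open>v\<close>. Only the
    quadratic part occurs in the normal form.\<close>
  have e_v: "mul e e \<bullet> (x + y + z) = 0"
    "mul e (x + y + z) \<bullet> (x + y + z) = - (x \<bullet> x) - (y \<bullet> y) / 2 + (z \<bullet> z) / 2"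
    if "x \<in> V1" "y \<in> V2" "z \<in> V3" for x y z
  proof -
    define v where "v = x + y + z"
    define G where "G = g111 x y z + g102 x y z + g012 x y z + g030 x y z"
    define q where "q = 2 * (x \<bullet> x) + y \<bullet> y - z \<bullet> z"
    have a: "1 *\<^sub>R e + 1 *\<^sub>R x + 1 *\<^sub>R y + 1 *\<^sub>R z = e + v"
      "- 1 *\<^sub>R e + 1 *\<^sub>R x + 1 *\<^sub>R y + 1 *\<^sub>R z = - e + v"
      "0 *\<^sub>R e + 1 *\<^sub>R x + 1 *\<^sub>R y + 1 *\<^sub>R z = v"
      by (simp_all add: v_def)
    have "F (e + v) = 1 - 3 / 2 * q + G" "F (- e + v) = - 1 + 3 / 2 * q + G" "F v = G"
      using F[OF that, of 1 1 1 1] F[OF that, of "-1" 1 1 1] F[OF that, of 0 1 1 1]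
      unfolding a by (simp_all add: G_def q_def)
    moreover have "F e = 1" using Fe by (simp add: F_def)
    moreover have "mul (- e) (- e) \<bullet> v = mul e e \<bullet> v" by (simp add: bs)
    ultimately have "mul e e \<bullet> v = 0" "mul e v \<bullet> v = - q / 2"
      using F_add[of e v] F_add[of "- e" v] F_neg[of e] rot[of e v v]
        inner_minus_right[of "mul v v" e] by linarith+
    then show "mul e e \<bullet> (x + y + z) = 0"
      "mul e (x + y + z) \<bullet> (x + y + z) = - (x \<bullet> x) - (y \<bullet> y) / 2 + (z \<bullet> z) / 2"
      by (simp_all add: v_def q_def field_simps)
  qed
  have e_vw: "mul e (x + y + z) \<bullet> (x' + y' + z') = - (x \<bullet> x') - (y \<bullet> y') / 2 + (z \<bullet> z') / 2"
    if v: "x \<in> V1" "y \<in> V2" "z \<in> V3" and w: "x' \<in> V1" "y' \<in> V2" "z' \<in> V3" for x y z x' y' z'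
  proof -
    define v where "v = x + y + z"
    define w where "w = x' + y' + z'"
    have "mul e (v + w) \<bullet> (v + w) = mul e v \<bullet> v + mul e w \<bullet> w + 2 * (mul e v \<bullet> w)"
      using rot[of e w v] rot[of w v e] comm[of v e] unfolding bs inner_add_left inner_add_right by simp
    moreover have "mul e (v + w) \<bullet> (v + w)
      = - ((x + x') \<bullet> (x + x')) - ((y + y') \<bullet> (y + y')) / 2 + ((z + z') \<bullet> (z + z')) / 2"
    proof -
      have a: "v + w = (x + x') + (y + y') + (z + z')" by (simp add: v_def w_def)
      show ?thesis unfolding a by (rule e_v(2); intro subspace_add V v w)
    qed
    ultimately show ?thesis
      using e_v(2)[OF v] e_v(2)[OF w]
      unfolding v_def[symmetric] w_def[symmetric]
      by (simp add: inner_add_left inner_add_right inner_commute[of x' x] inner_commute[of y' y]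
          inner_commute[of z' z] field_simps)
  qed
  \<comment> \<open>A vector is determined by its inner products with \<open>e\<close> and with sums
    of Peirce components. This turns the scalar formulas \<open>e_v\<close> and \<open>e_vw\<close>
    into the eigenvector equations for multiplication by \<open>e\<close>.\<close>
  have eqI: "u = v" if "u \<bullet> e = v \<bullet> e" "\<And>x y z. x \<in> V1 \<Longrightarrow> y \<in> V2 \<Longrightarrow> z \<in> V3 \<Longrightarrow>
      u \<bullet> (x + y + z) = v \<bullet> (x + y + z)" for u v
  proof -
    have "(u - v) \<bullet> w = 0" for w
    proof -
      obtain t x y z where w: "x \<in> V1" "y \<in> V2" "z \<in> V3" "w = t *\<^sub>R e + (x + y + z)"
        using dec[of w] by (auto simp: add.assoc)
      show ?thesis
        unfolding w(4) inner_diff_left inner_add_right[of _ "t *\<^sub>R e"] inner_scaleR_right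
        using that(1) that(2)[OF w(1-3)] by simp
    qed
    from this[of "u - v"] show ?thesis by simp
  qed
  have mul_ee: "mul e e = e"
  proof (rule eqI)
    show "mul e e \<bullet> e = e \<bullet> e" by (simp add: Fe ee)
    show "mul e e \<bullet> (x + y + z) = e \<bullet> (x + y + z)" if "x \<in> V1" "y \<in> V2" "z \<in> V3" for x y z
      unfolding e_v(1)[OF that] using that by (simp add: inner_add_right oe)
  qed
  have ev_e: "mul e v \<bullet> e = 0" if "mul e e \<bullet> v = 0" for v using rot[of e v e] rot[of v e e] that by simp
  have pe1: "mul e x = - x" if x: "x \<in> V1" for x
  proof (rule eqI)
    show "mul e x \<bullet> e = (- x) \<bullet> e"
      using ev_e[of x] e_v(1)[OF x z0(2,3)] x by (simp add: os)
    show "mul e x \<bullet> (x' + y' + z') = (- x) \<bullet> (x' + y' + z')" if "x' \<in> V1" "y' \<in> V2" "z' \<in> V3" for x' y' z'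
      using e_vw[OF x z0(2,3) that] x that by (simp add: inner_add_right o)
  qed
  have pe2: "mul e y = - (1 / 2) *\<^sub>R y" if y: "y \<in> V2" for y
  proof (rule eqI)
    show "mul e y \<bullet> e = (- (1 / 2) *\<^sub>R y) \<bullet> e"
      using ev_e[of y] e_v(1)[OF z0(1) y z0(3)] y by (simp add: os)
    show "mul e y \<bullet> (x' + y' + z') = (- (1 / 2) *\<^sub>R y) \<bullet> (x' + y' + z')"
      if "x' \<in> V1" "y' \<in> V2" "z' \<in> V3" for x' y' z'
      using e_vw[OF z0(1) y z0(3) that] y that by (simp add: inner_add_right o os)
  qed
  have pe3: "mul e z = (1 / 2) *\<^sub>R z" if z: "z \<in> V3" for z
  proof (rule eqI)
    show "mul e z \<bullet> e = ((1 / 2) *\<^sub>R z) \<bullet> e"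
      using ev_e[of z] e_v(1)[OF z0(1,2) z] z by (simp add: os)
    show "mul e z \<bullet> (x' + y' + z') = ((1 / 2) *\<^sub>R z) \<bullet> (x' + y' + z')"
      if "x' \<in> V1" "y' \<in> V2" "z' \<in> V3" for x' y' z'
      using e_vw[OF z0(1,2) z that] z that by (simp add: inner_add_right os)
  qed
  obtain p1 where p1: "linear p1" "\<And>x. p1 x \<in> V1" "\<And>x v. v \<in> V1 \<Longrightarrow> p1 x \<bullet> v = x \<bullet> v"
    "(\<Sum>b\<in>Basis. p1 b \<bullet> b) = dim V1" using ex_orthogonal_projection[OF V(1)] by blast
  obtain p2 where p2: "linear p2" "\<And>x. p2 x \<in> V2" "\<And>x v. v \<in> V2 \<Longrightarrow> p2 x \<bullet> v = x \<bullet> v"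
    "(\<Sum>b\<in>Basis. p2 b \<bullet> b) = dim V2" using ex_orthogonal_projection[OF V(2)] by blast
  obtain p3 where p3: "linear p3" "\<And>x. p3 x \<in> V3" "\<And>x v. v \<in> V3 \<Longrightarrow> p3 x \<bullet> v = x \<bullet> v"
    "(\<Sum>b\<in>Basis. p3 b \<bullet> b) = dim V3" using ex_orthogonal_projection[OF V(3)] by blast
  have decomp: "v = (v \<bullet> e) *\<^sub>R e + p1 v + p2 v + p3 v" for v
  proof (rule eqI)
    show "v \<bullet> e = ((v \<bullet> e) *\<^sub>R e + p1 v + p2 v + p3 v) \<bullet> e"
      using p1(2) p2(2) p3(2) by (simp add: inner_add_left ee os)
    show "v \<bullet> (x + y + z) = ((v \<bullet> e) *\<^sub>R e + p1 v + p2 v + p3 v) \<bullet> (x + y + z)"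
      if "x \<in> V1" "y \<in> V2" "z \<in> V3" for x y z
      using that p1(2,3) p2(2,3) p3(2,3) by (simp add: inner_add_left inner_add_right oe o os)
  qed
  have "peirce_type_3_8 mul e V1 V2 V3 p1 p2 p3 (c\<^sup>2 * l / 54)"
  proof (intro peirce_type_3_8.intro peirce_type_3_8_axioms.intro peirce_decomposition.intro)
    show "bilinear mul" by (rule bil)
    show "mul x y = mul y x" for x y by (rule comm)
    show "mul x y \<bullet> z = x \<bullet> mul y z" for x y z by (rule assoc)
    show "v = (v \<bullet> e) *\<^sub>R e + p1 v + p2 v + p3 v" for v by (rule decomp)
    show "mul v v \<bullet> v = 0" if "v \<in> V1" for v using F1[OF that] by (simp add: F_def)
    show "mul v v \<bullet> v = 0" if "v \<in> V3" for v using F3[OF that] by (simp add: F_def)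
    show "(mul x x \<bullet> mul x x) * (\<Sum>b\<in>Basis. mul x b \<bullet> b) - mul x (mul x x) \<bullet> mul x x
      = (c\<^sup>2 * l / 54) * (x \<bullet> x) * (mul x x \<bullet> x)" for x by (rule hs)
  qed (fact V p1 p2 p3 ee oe o mul_ee pe1 pe2 pe3 n12 n13 n23 dims)+
  then show False by (rule peirce_type_3_8.no_type_3_8)
qed

theorem proposition7p5:
  shows "\<not> (\<exists>f :: real ^ 'n::finite \<Rightarrow> real. exceptional_eigencubic f \<and> has_type f 3 8)"
  using no_normal_form_3_8 unfolding exceptional_eigencubic_def has_type_def by blast

end
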